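(* Let $1/2<s\le 1$, let $u_0$ be smooth and $2\pi$-periodic, and let $u^{N}$ be the solution of the semidiscrete problem $\frac{d}{dt}u^{N}=F(u^{N})$, $0\le t\le T$, $u^{N}(0)=P_Nu_0$. With $I_1=I_1(u^N(0))$, $E=H(u^N(0))$ and $C_\infty=\big(\sum_{k=-\infty}^{\infty}\frac{1}{1+|k|^{2s}}\big)^{1/2}$, assume that $$C_*:=1-C_\infty^2I_1>0,\qquad \frac{I_1}{2}+E\ge 0 .$$ Assume that the solution $u$ of the periodic problem $iu_t-(-\partial_{xx})^su+|u|^2u=0$, $u(x,0)=u_0(x)$, is in $H^{\mu}$, $\mu>0$, for $t\in[0,T]$, with $\sup_{0\le t\le T}\|u(t)\|_\mu<\infty$. Then $$\max_{0\le t\le T}\|u^{N}(t)-u(t)\|\lesssim N^{-\mu},$$ with implied constant independent of $N$.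
   Context: $T>0$ is fixed. All functions are complex-valued and $2\pi$-periodic in $x$; $L^2=L^2(-\pi,\pi)$ with $(u_1,u_2)=\int_{-\pi}^{\pi}u_1\overline{u_2}\,dx$ and induced norm $\|\cdot\|$. $\widehat u(k)=\frac1{2\pi}\int_{-\pi}^{\pi}u(x)e^{-ikx}dx$. For $\mu\ge0$, $H^\mu$ is the periodic Sobolev space with norm $\|u\|_\mu=(\sum_{k\in\mathbb Z}(1+k^2)^\mu|\widehat u(k)|^2)^{1/2}$. $(-\partial_{xx})^{s}$ is the Fourier multiplier with symbol $|k|^{2s}$, $|D|^s=(-\partial_{xx})^{s/2}$. $N\ge1$ is an integer, $S_N=\mathrm{span}\{e^{ikx}:-N\le k\le N\}$, $P_Nu=\sum_{|k|\le N}\widehat u(k)e^{ikx}$. $F:S_N\to S_N$ is $F(u)=-i(-\partial_{xx})^su+iP_N(|u|^2u)$, so that $u^N:[0,T]\to S_N$ satisfies $(iu^N_t-(-\partial_{xx})^su^N+|u^N|^2u^N,\varphi)=0$ for all $\varphi\in S_N$. $I_1(u)=\frac12\int_{-\pi}^{\pi}|u|^2dx$, $H(u)=\frac12\int_{-\pi}^{\pi}\big(||D|^su|^2-\frac12|u|^4\big)dx$. $g_1\lesssim g_2$ means $g_1\le Cg_2$ for some constant $C$. *)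

theory Defs
  imports "HOL-Analysis.Analysis"
begin

definition periodic2pi :: "(real \<Rightarrow> complex) \<Rightarrow> bool" where
  "periodic2pi f \<longleftrightarrow> (\<forall>x. f (x + 2 * pi) = f x)"

(* D n is the n-th derivative of f. *)
definition smooth :: "(real \<Rightarrow> complex) \<Rightarrow> bool" where
  "smooth f \<longleftrightarrow> (\<exists>D :: nat \<Rightarrow> real \<Rightarrow> complex. D 0 = f \<and>
     (\<forall>n x. (D n has_vector_derivative D (Suc n) x) (at x)))"

definition L2_per :: "(real \<Rightarrow> complex) set" where
  "L2_per = {f. periodic2pi f \<and> f \<in> borel_measurable (lebesgue_on {-pi..pi}) \<and>
     integrable (lebesgue_on {-pi..pi}) (\<lambda>x. (cmod (f x))\<^sup>2)}"

definition L2_inner :: "(real \<Rightarrow> complex) \<Rightarrow> (real \<Rightarrow> complex) \<Rightarrow> complex" where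
  "L2_inner f g = (LINT x | lebesgue_on {-pi..pi}. f x * cnj (g x))"

definition L2_norm_per :: "(real \<Rightarrow> complex) \<Rightarrow> real" where
  "L2_norm_per f = sqrt (Re (L2_inner f f))"

definition fourier_mode :: "int \<Rightarrow> real \<Rightarrow> complex" where
  "fourier_mode k x = exp (\<i> * of_int k * of_real x)"

definition fourier_coeff :: "(real \<Rightarrow> complex) \<Rightarrow> int \<Rightarrow> complex" where
  "fourier_coeff f k =
     1 / (2 * of_real pi) * (LINT x | lebesgue_on {-pi..pi}. f x * fourier_mode (- k) x)"

definition sobolev_space :: "real \<Rightarrow> (real \<Rightarrow> complex) set" where
  "sobolev_space \<mu> = {f \<in> L2_per.
     (\<lambda>k::int. (1 + (real_of_int k)\<^sup>2) powr \<mu> * (cmod (fourier_coeff f k))\<^sup>2) summable_on UNIV}"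

definition sobolev_norm :: "real \<Rightarrow> (real \<Rightarrow> complex) \<Rightarrow> real" where
  "sobolev_norm \<mu> f =
     sqrt (\<Sum>\<^sub>\<infinity>k::int. (1 + (real_of_int k)\<^sup>2) powr \<mu> * (cmod (fourier_coeff f k))\<^sup>2)"

(* The symbol of (-d^2/dx^2)^s; its value at k = 0 is 0 because 0 powr a = 0. *)
definition frac_symbol :: "real \<Rightarrow> int \<Rightarrow> real" where
  "frac_symbol s k = \<bar>real_of_int k\<bar> powr (2 * s)"

(* Pointwise Fourier series; below it is only applied to trigonometric polynomials,
   for which the sum has finite support. *)
definition frac_lap :: "real \<Rightarrow> (real \<Rightarrow> complex) \<Rightarrow> real \<Rightarrow> complex" where
  "frac_lap s f x =
     (\<Sum>\<^sub>\<infinity>k::int. of_real (frac_symbol s k) * fourier_coeff f k * fourier_mode k x)"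

definition abs_D :: "real \<Rightarrow> (real \<Rightarrow> complex) \<Rightarrow> real \<Rightarrow> complex" where
  "abs_D s = frac_lap (s / 2)"

definition trig_space :: "nat \<Rightarrow> (real \<Rightarrow> complex) set" where
  "trig_space N =
     {f. \<exists>c :: int \<Rightarrow> complex. f = (\<lambda>x. \<Sum>k\<in>{- int N..int N}. c k * fourier_mode k x)}"

definition trig_proj :: "nat \<Rightarrow> (real \<Rightarrow> complex) \<Rightarrow> real \<Rightarrow> complex" where
  "trig_proj N f x = (\<Sum>k\<in>{- int N..int N}. fourier_coeff f k * fourier_mode k x)"

definition cubic :: "(real \<Rightarrow> complex) \<Rightarrow> real \<Rightarrow> complex" where
  "cubic f x = of_real ((cmod (f x))\<^sup>2) * f x"

definition semidiscrete_rhs :: "real \<Rightarrow> nat \<Rightarrow> (real \<Rightarrow> complex) \<Rightarrow> real \<Rightarrow> complex" where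
  "semidiscrete_rhs s N f x = - \<i> * frac_lap s f x + \<i> * trig_proj N (cubic f) x"

(* Since trig_space N is finite-dimensional, differentiability in t with values in it
   is the same as pointwise differentiability in t for every x. *)
definition semidiscrete_solution ::
    "real \<Rightarrow> real \<Rightarrow> nat \<Rightarrow> (real \<Rightarrow> complex) \<Rightarrow> (real \<Rightarrow> real \<Rightarrow> complex) \<Rightarrow> bool" where
  "semidiscrete_solution s T N u0 v \<longleftrightarrow>
     (\<forall>t\<in>{0..T}. v t \<in> trig_space N) \<and>
     (\<forall>t\<in>{0..T}. \<forall>x.
        ((\<lambda>\<tau>. v \<tau> x) has_vector_derivative semidiscrete_rhs s N (v t) x) (at t within {0..T})) \<and>
     v 0 = trig_proj N u0"

(* Weak solutions of i u_t - (-d^2/dx^2)^s u + |u|^2 u = 0, u(0) = u0, in the energy class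
   L^infinity(0,T; H^s): the equation is tested against every mode exp (i k x).  For s > 1/2,
   H^s embeds into the bounded functions, so cubic (u t) is square integrable. Classical
   solutions and C([0,T]; H^s) solutions are included. *)
definition fnls_solution ::
    "real \<Rightarrow> real \<Rightarrow> (real \<Rightarrow> complex) \<Rightarrow> (real \<Rightarrow> real \<Rightarrow> complex) \<Rightarrow> bool" where
  "fnls_solution s T u0 u \<longleftrightarrow>
     (\<forall>t\<in>{0..T}. u t \<in> sobolev_space s) \<and>
     bdd_above ((\<lambda>t. sobolev_norm s (u t)) ` {0..T}) \<and>
     (\<forall>t\<in>{0..T}. \<forall>k.
        ((\<lambda>\<tau>. fourier_coeff (u \<tau>) k) has_vector_derivative
           (- \<i> * of_real (frac_symbol s k) * fourier_coeff (u t) k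
              + \<i> * fourier_coeff (cubic (u t)) k)) (at t within {0..T})) \<and>
     (AE x in lebesgue. u 0 x = u0 x)"

definition mass_I1 :: "(real \<Rightarrow> complex) \<Rightarrow> real" where
  "mass_I1 f = 1 / 2 * (LINT x | lebesgue_on {-pi..pi}. (cmod (f x))\<^sup>2)"

definition energy_H :: "real \<Rightarrow> (real \<Rightarrow> complex) \<Rightarrow> real" where
  "energy_H s f = 1 / 2 * (LINT x | lebesgue_on {-pi..pi}.
     (cmod (abs_D s f x))\<^sup>2 - 1 / 2 * (cmod (f x)) ^ 4)"

definition C_infty :: "real \<Rightarrow> real" where
  "C_infty s = sqrt (\<Sum>\<^sub>\<infinity>k::int. 1 / (1 + \<bar>real_of_int k\<bar> powr (2 * s)))"

end

theory Submission
  imports Defs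
begin

text \<open>
  Let \<open>e = P\<^sub>N u - u\<^sup>N\<close>, a trigonometric polynomial with \<open>e(0) = 0\<close>. The dispersive term does not
  contribute to the derivative of \<open>y = \<Sum>\<bar>e\<^sub>k\<bar>\<^sup>2\<close>, and as long as \<open>u\<close> and \<open>u\<^sup>N\<close> are bounded by \<open>R\<close> the
  Lipschitz bound for the cubic term gives \<open>y' \<le> 9R\<^sup>2(y + \<delta>\<^sup>2/3)\<close> with \<open>\<delta>\<close> proportional to the truncation
  error \<open>\<parallel>u - P\<^sub>N u\<parallel>\<close>, which is \<open>O(N\<^sup>-\<^sup>\<mu>)\<close>; Gronwall's inequality then gives the claim.

  The uniform bound on \<open>u\<^sup>N\<close> comes from a bootstrap: \<open>u\<close> is bounded in \<open>H\<^sup>s\<close>, so the same estimate with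
  \<open>\<mu>\<close> replaced by \<open>s\<close> gives \<open>y = O(N\<^sup>-\<^sup>2\<^sup>s)\<close>, and \<open>\<bar>e(x)\<bar>\<^sup>2 \<le> (2N+1) y = O(N\<^sup>1\<^sup>-\<^sup>2\<^sup>s)\<close> tends to 0 because
  \<open>s > 1/2\<close>. For the finitely many \<open>N\<close> for which this is not yet small, conservation of mass bounds the
  error by a constant.
\<close>

section \<open>Fourier modes\<close>

abbreviation "Lpi \<equiv> lebesgue_on {-pi..pi}"

lemma fourier_mode_mult: "fourier_mode j x * fourier_mode k x = fourier_mode (j + k) x"
  by (simp add: fourier_mode_def exp_add[symmetric] algebra_simps)

lemma norm_fourier_mode [simp]: "cmod (fourier_mode k x) = 1"
  by (simp add: fourier_mode_def norm_exp_eq_Re)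

lemma fourier_mode_0 [simp]: "fourier_mode 0 x = 1"
  by (simp add: fourier_mode_def)

lemma cnj_fourier_mode: "cnj (fourier_mode k x) = fourier_mode (- k) x"
  by (simp add: fourier_mode_def exp_cnj)

lemma fourier_mode_cis: "fourier_mode k x = cis (of_int k * x)"
  by (simp add: fourier_mode_def cis_conv_exp mult_ac)

lemma continuous_on_fourier_mode [continuous_intros]: "continuous_on S (fourier_mode k)"
  unfolding fourier_mode_def[abs_def] by (intro continuous_intros)

lemma measurable_lebesgue_on_pi:
  fixes f :: "real \<Rightarrow> 'a::euclidean_space"
  shows "continuous_on UNIV f \<Longrightarrow> f \<in> borel_measurable Lpi"
  by (metis continuous_imp_measurable_on_sets_lebesgue continuous_on_subset fmeasurableD lmeasurable_cbox box_real(2) subset_UNIV)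

lemma fourier_mode_measurable [measurable]: "fourier_mode k \<in> borel_measurable Lpi"
  by (intro measurable_lebesgue_on_pi continuous_intros)

lemma finite_measure_Lpi: "finite_measure Lpi"
  by (metis box_real(2) finite_measure_lebesgue_on lmeasurable_cbox)

lemma measure_Lpi: "measure Lpi (space Lpi) = 2 * pi"
  by (simp add: measure_restrict_space)

lemma integrable_bounded_Lpi:
  fixes f :: "real \<Rightarrow> complex"
  assumes "f \<in> borel_measurable Lpi" "AE x in Lpi. cmod (f x) \<le> B"
  shows "integrable Lpi f"
  using assms finite_measure.integrable_const_bound[OF finite_measure_Lpi] by blast

lemma integrable_mult_bounded:
  fixes f p :: "'a \<Rightarrow> complex"
  assumes "integrable M f" "p \<in> borel_measurable M" "\<And>x. cmod (p x) \<le> B"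
  shows "integrable M (\<lambda>x. f x * p x)"
proof (rule Bochner_Integration.integrable_bound[of _ "\<lambda>x. B * f x"])
  show "AE x in M. norm (f x * p x) \<le> norm (complex_of_real B * f x)"
  proof (rule AE_I2)
    fix x
    have "0 \<le> B" using assms(3)[of x] norm_ge_zero order_trans by blast
    then show "norm (f x * p x) \<le> norm (complex_of_real B * f x)"
      using assms(3)[of x] by (simp add: norm_mult mult.commute[of "cmod (f x)"] mult_right_mono)
  qed
qed (use assms in auto)

lemma integrable_mult_mode: "integrable Lpi f \<Longrightarrow> integrable Lpi (\<lambda>x. f x * fourier_mode k x)"
  by (rule integrable_mult_bounded[where B=1]) auto

lemma integrable_fourier_mode [simp]: "integrable Lpi (fourier_mode k)"
  by (rule integrable_bounded_Lpi[where B=1]) auto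

text \<open>For k nonzero the antiderivative e^(ikx)/(ik) takes equal values at -pi and pi, so the
  integral over a full period vanishes.\<close>

lemma integral_fourier_mode:
  "(LINT x|Lpi. fourier_mode k x) = (if k = 0 then 2 * of_real pi else 0)"
proof (cases "k = 0")
  case True
  then show ?thesis
    using measure_Lpi by (simp add: scaleR_conv_of_real)
next
  case False
  have "((\<lambda>x. fourier_mode k x / (\<i> * of_int k)) has_vector_derivative fourier_mode k x)
          (at x within {-pi..pi})" for x
    unfolding fourier_mode_def
    by (rule has_vector_derivative_eq_rhs,
        rule has_vector_derivative_real_field[of "\<lambda>z. exp (\<i> * of_int k * z) / (\<i> * of_int k)"])
       (auto intro!: derivative_eq_intros simp: False)
  then have "(fourier_mode k has_integral
      (fourier_mode k pi / (\<i> * of_int k) - fourier_mode k (-pi) / (\<i> * of_int k))) {-pi..pi}"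
    by (intro fundamental_theorem_of_calculus) auto
  moreover have "fourier_mode k pi = fourier_mode k (-pi)"
  proof -
    have "fourier_mode k pi = fourier_mode k (-pi) * cis (2 * pi * of_int k)"
      by (simp add: fourier_mode_cis cis_mult algebra_simps)
    then show ?thesis by (simp add: cis_multiple_2pi)
  qed
  ultimately have "(fourier_mode k has_integral 0) {-pi..pi}" by simp
  then have "integral {-pi..pi} (fourier_mode k) = 0" by blast
  then show ?thesis
    using False lebesgue_integral_eq_integral[of "{-pi..pi}" "fourier_mode k"] by auto
qed

section \<open>Integrable functions whose Fourier coefficients all vanish\<close>

text \<open>Integrability belongs to the notion because the Bochner integral of a non-integrable
  function is 0 by default. The sign of \<open>k\<close> is immaterial as \<open>k\<close> ranges
  over all integers.\<close>

definition null_coeffs :: "(real \<Rightarrow> complex) \<Rightarrow> bool" where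
  "null_coeffs f \<longleftrightarrow> integrable Lpi f \<and> (\<forall>k. (LINT x|Lpi. f x * fourier_mode k x) = 0)"

lemma null_coeffs_mult_mode:
  assumes "null_coeffs f" shows "null_coeffs (\<lambda>x. f x * fourier_mode k x)"
  using assms unfolding null_coeffs_def
  by (auto intro: integrable_mult_mode simp: mult.assoc fourier_mode_mult)

lemma null_coeffs_lincomb:
  assumes "null_coeffs f" "null_coeffs g"
  shows "null_coeffs (\<lambda>x. a * f x + b * g x)"
proof -
  have "(LINT x|Lpi. (a * f x + b * g x) * fourier_mode k x) = 0" for k
  proof -
    have "(LINT x|Lpi. (a * f x + b * g x) * fourier_mode k x)
        = (LINT x|Lpi. a * (f x * fourier_mode k x) + b * (g x * fourier_mode k x))"
      by (simp add: algebra_simps)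
    also have "\<dots> = a * (LINT x|Lpi. f x * fourier_mode k x) + b * (LINT x|Lpi. g x * fourier_mode k x)"
      using assms by (subst Bochner_Integration.integral_add)
        (auto simp: null_coeffs_def intro!: integrable_mult_mode)
    finally show ?thesis using assms by (simp add: null_coeffs_def)
  qed
  then show ?thesis using assms by (auto simp: null_coeffs_def)
qed

text \<open>Multiplication by a mode only shifts the coefficients, and a real-linear function of
  \<open>cis x\<close> is a combination of the modes 1 and -1. The induction keeps \<open>f\<close>
  arbitrary because in the product case one hypothesis is applied to \<open>f\<close> times the
  other factor.\<close>

lemma null_coeffs_mult_polynomial:
  fixes p :: "complex \<Rightarrow> real"
  assumes "real_polynomial_function p" "null_coeffs f"
  shows "null_coeffs (\<lambda>x. f x * of_real (p (cis x)))"
  using assms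
proof (induction arbitrary: f)
  case (linear p)
  \<comment> \<open>A real-linear \<open>p\<close> is determined by its values at 1 and \<i>;
    Euler's formulas then turn cosine and sine into the two modes.\<close>
  have "of_real (p (cis x)) = (of_real (p 1) / 2 + of_real (p \<i>) / (2 * \<i>)) * fourier_mode 1 x
      + (of_real (p 1) / 2 - of_real (p \<i>) / (2 * \<i>)) * fourier_mode (-1) x" for x
  proof -
    have "cis x = cos x *\<^sub>R 1 + sin x *\<^sub>R \<i>"
      by (simp add: complex_eq_iff)
    then have "p (cis x) = cos x * p 1 + sin x * p \<i>"
      using linear(1) by (simp add: linear_add linear_scale bounded_linear.linear)
    moreover have "fourier_mode 1 x = cos x + \<i> * sin x" "fourier_mode (-1) x = cos x - \<i> * sin x"
      by (simp_all add: fourier_mode_cis complex_eq_iff)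
    ultimately show ?thesis
      by (simp add: field_simps complex_eq_iff)
  qed
  note eq = this
  have "f x * of_real (p (cis x)) =
       (of_real (p 1) / 2 + of_real (p \<i>) / (2 * \<i>)) * (f x * fourier_mode 1 x)
      + (of_real (p 1) / 2 - of_real (p \<i>) / (2 * \<i>)) * (f x * fourier_mode (-1) x)" for x
    by (subst eq) (simp only: algebra_simps)
  then show ?case
    by (simp only:) (intro null_coeffs_lincomb null_coeffs_mult_mode linear)
next
  case (const c)
  then show ?case using null_coeffs_lincomb[of f f c 0] by (simp add: mult.commute)
next
  case (add p q)
  then show ?case
    using null_coeffs_lincomb[of "\<lambda>x. f x * of_real (p (cis x))" "\<lambda>x. f x * of_real (q (cis x))" 1 1]
    by (simp add: algebra_simps)
next
  case (mult p q)
  then show ?case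
    by (simp add: mult.assoc[symmetric])
qed

section \<open>Uniqueness of Fourier coefficients\<close>

text \<open>The cutoff removes the jump of \<^const>\<open>Arg\<close> at \<open>-1\<close>.\<close>
lemma continuous_on_circle_cutoff:
  fixes g :: "real \<Rightarrow> complex"
  assumes "continuous_on UNIV g" "\<And>x. cmod (g x) \<le> 1"
  shows "continuous_on (sphere 0 1) (\<lambda>z. g (Arg z) * of_real (min 1 (c * cmod (z + 1))))"
  unfolding continuous_on_eq_continuous_within
proof
  fix z :: complex assume z: "z \<in> sphere 0 1"
  let ?G = "\<lambda>z. g (Arg z) * of_real (min 1 (c * cmod (z + 1)))"
  have "isCont ?G z"
  proof (cases "z = -1")
    case True
    have "(\<lambda>w. of_real (min 1 (c * cmod (w + 1))) :: complex) \<midarrow>-1\<rightarrow> of_real (min 1 (c * cmod (-1 + 1)))"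
      by (intro tendsto_intros)
    then have "(\<lambda>w. cmod (of_real (min 1 (c * cmod (w + 1))))) \<midarrow>-1\<rightarrow> 0"
      by (auto dest: tendsto_norm)
    then have "((\<lambda>w. g (Arg w) * of_real (min 1 (c * cmod (w + 1)))) \<longlongrightarrow> 0) (at (-1))"
    proof (rule Lim_null_comparison[rotated])
      show "\<forall>\<^sub>F w in at (-1). cmod (g (Arg w) * of_real (min 1 (c * cmod (w + 1))))
          \<le> cmod (of_real (min 1 (c * cmod (w + 1))))"
        by (rule always_eventually) (simp add: norm_mult assms(2) mult_left_le_one_le del: norm_of_real)
    qed
    then show ?thesis using True by (simp add: isCont_def)
  next
    case False
    have "z \<notin> \<real>\<^sub>\<le>\<^sub>0"
    proof
      assume "z \<in> \<real>\<^sub>\<le>\<^sub>0"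
      then obtain r where "z = of_real r" "r \<le> 0" by (auto elim: nonpos_Reals_cases)
      with z False show False by auto
    qed
    moreover have "isCont g (Arg z)" using assms(1) by (simp add: continuous_on_eq_continuous_at)
    ultimately show ?thesis
      by (intro continuous_intros isCont_o2[of z Arg g] continuous_at_Arg)
  qed
  then show "continuous (at z within sphere 0 1) ?G"
    by (rule continuous_at_imp_continuous_within)
qed

lemma AE_Lpi_not_pi: "AE x in Lpi. x \<in> {-pi<..<pi}"
proof -
  have "AE x in lebesgue. x \<notin> {-pi, pi}"
    by (rule AE_not_in) (simp add: negligible_iff_null_sets[symmetric])
  then show ?thesis
    by (subst AE_restrict_space_iff) (auto intro: order_le_neq_trans elim!: AE_mp)
qed

text \<open>A measurable function is an almost everywhere limit of continuous ones; after a cutoff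
  near -1 these live on the circle, where Stone-Weierstrass replaces them by polynomials. The
  uniform bound 2 serves dominated convergence later.\<close>

lemma circle_polynomials_approximate_measurable:
  fixes h :: "real \<Rightarrow> complex"
  assumes "h \<in> borel_measurable Lpi" "\<And>x. cmod (h x) \<le> 1"
  obtains p :: "nat \<Rightarrow> complex \<Rightarrow> complex"
    where "\<And>n. polynomial_function (p n)" "\<And>n x. cmod (p n (cis x)) \<le> 2"
      "AE x in Lpi. (\<lambda>n. p n (cis x)) \<longlonglongrightarrow> h x"
proof -
  have "h measurable_on {-pi..pi}"
    using assms(1) by (subst measurable_on_iff_borel_measurable) auto
  then obtain N g where N: "negligible N" and g: "\<And>n. continuous_on UNIV (g n)"
    and lim: "\<And>x. x \<notin> N \<Longrightarrow> (\<lambda>n. g n x) \<longlonglongrightarrow> (if x \<in> {-pi..pi} then h x else 0)"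
    unfolding measurable_on_def by blast
  \<comment> \<open>Radial retraction onto the closed unit disc. It fixes the values of
    \<open>h\<close>, so the limit is unchanged.\<close>
  define g' where "g' n x = g n x / of_real (max 1 (cmod (g n x)))" for n x
  have g'_le: "cmod (g' n x) \<le> 1" for n x
    by (auto simp: g'_def norm_divide divide_simps)
  have g'_cont: "continuous_on UNIV (g' n)" for n
    unfolding g'_def[abs_def] by (intro continuous_intros g) auto
  have g'_lim: "(\<lambda>n. g' n x) \<longlonglongrightarrow> h x" if "x \<notin> N" "x \<in> {-pi..pi}" for x
  proof -
    have "(\<lambda>n. g n x) \<longlonglongrightarrow> h x" using lim[of x] that by simp
    then have "(\<lambda>n. g' n x) \<longlonglongrightarrow> h x / of_real (max 1 (cmod (h x)))"
      unfolding g'_def by (intro tendsto_intros) auto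
    then show ?thesis using assms(2)[of x] by (simp add: max_absorb1)
  qed
  \<comment> \<open>The cutoff factor vanishes at -1, and at any other point of the circle it equals
    1 for all large \<open>n\<close>.\<close>
  define G where "G n z = g' n (Arg z) * of_real (min 1 (real n * cmod (z + 1)))" for n z
  have "continuous_on (sphere 0 1) (G n)" for n
    unfolding G_def by (rule continuous_on_circle_cutoff[OF g'_cont g'_le])
  then have "\<exists>p. polynomial_function p \<and> (\<forall>z\<in>sphere 0 1. norm (G n z - p z) < 1 / Suc n)" for n
    by (intro Stone_Weierstrass_polynomial_function) auto
  then obtain p where p: "\<And>n. polynomial_function (p n)"
    and pG: "\<And>n z. z \<in> sphere 0 1 \<Longrightarrow> norm (G n z - p n z) < 1 / Suc n"
    by metis
  show ?thesis
  proof
    show "polynomial_function (p n)" for n by (rule p)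
    show "cmod (p n (cis x)) \<le> 2" for n x
    proof -
      have "cmod (G n (cis x)) \<le> 1 * 1"
        unfolding G_def norm_mult by (intro mult_mono g'_le) auto
      moreover have "norm (G n (cis x) - p n (cis x)) < 1 / Suc n"
        by (rule pG) simp
      moreover have "1 / real (Suc n) \<le> 1" by simp
      moreover have "cmod (p n (cis x)) \<le> cmod (G n (cis x)) + norm (G n (cis x) - p n (cis x))"
        by (metis norm_triangle_sub norm_minus_commute)
      ultimately show ?thesis by linarith
    qed
    \<comment> \<open>The endpoints -pi and pi are left out: both are mapped to -1, where the cutoff
      destroys the value.\<close>
    have conv: "(\<lambda>n. p n (cis x)) \<longlonglongrightarrow> h x" if "x \<notin> N" "x \<in> {-pi<..<pi}" for x
    proof -
      have "cis x \<noteq> -1"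
      proof
        assume "cis x = -1"
        then have "cos x = -1" by (metis cis.sel(1) one_complex.sel(1) uminus_complex.sel(1))
        moreover have "cos x > -1"
          using cos_monotone_0_pi[of "\<bar>x\<bar>" pi] that by (simp add: cos_abs_real abs_less_iff)
        ultimately show False by simp
      qed
      then have pos: "cmod (cis x + 1) > 0" by (auto simp: add_eq_0_iff2)
      have "eventually (\<lambda>n. real n \<ge> 1 / cmod (cis x + 1)) sequentially"
        by (rule eventually_ge_at_top[THEN filterlim_real_sequentially[unfolded filterlim_iff, rule_format]])
      then have "eventually (\<lambda>n. G n (cis x) = g' n x) sequentially"
      proof eventually_elim
        case (elim n)
        then have "min 1 (real n * cmod (cis x + 1)) = 1" using pos by (simp add: field_simps)
        then show ?case using that by (simp add: G_def Arg_cis)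
      qed
      then have "(\<lambda>n. G n (cis x)) \<longlonglongrightarrow> h x"
        using g'_lim[of x] that by (auto simp: tendsto_cong)
      moreover have "(\<lambda>n. G n (cis x) - p n (cis x)) \<longlonglongrightarrow> 0"
      proof (rule Lim_null_comparison)
        show "\<forall>\<^sub>F n in sequentially. norm (G n (cis x) - p n (cis x)) \<le> 1 / Suc n"
          by (rule always_eventually) (simp add: less_imp_le[OF pG[of "cis x"], simplified])
        show "(\<lambda>n. 1 / real (Suc n)) \<longlonglongrightarrow> 0"
          using LIMSEQ_inverse_real_of_nat by (simp add: inverse_eq_divide)
      qed
      ultimately show ?thesis using tendsto_diff by fastforce
    qed
    have "AE x in Lpi. x \<notin> N"
    proof -
      have "AE x in lebesgue. x \<notin> N"
        using N by (intro AE_not_in) (simp add: negligible_iff_null_sets)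
      then show ?thesis by (auto simp: AE_restrict_space_iff)
    qed
    then show "AE x in Lpi. (\<lambda>n. p n (cis x)) \<longlonglongrightarrow> h x"
      using AE_Lpi_not_pi by eventually_elim (use conv in auto)
  qed
qed

lemma null_coeffs_mult_complex_polynomial:
  fixes p :: "complex \<Rightarrow> complex"
  assumes "polynomial_function p" "null_coeffs f"
  shows "null_coeffs (\<lambda>x. f x * p (cis x))"
proof -
  have "real_polynomial_function (Re \<circ> p)" "real_polynomial_function (Im \<circ> p)"
    using assms(1) bounded_linear_Re bounded_linear_Im unfolding polynomial_function_def by blast+
  then have "null_coeffs (\<lambda>x. f x * of_real ((Re \<circ> p) (cis x)))"
      "null_coeffs (\<lambda>x. f x * of_real ((Im \<circ> p) (cis x)))"
    using null_coeffs_mult_polynomial assms(2) by blast+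
  then have "null_coeffs (\<lambda>x. 1 * (f x * of_real ((Re \<circ> p) (cis x))) + \<i> * (f x * of_real ((Im \<circ> p) (cis x))))"
    by (rule null_coeffs_lincomb)
  moreover have "f x * p (cis x) = 1 * (f x * of_real ((Re \<circ> p) (cis x))) + \<i> * (f x * of_real ((Im \<circ> p) (cis x)))" for x
    by (subst complex_eq[of "p (cis x)"]) (simp add: algebra_simps)
  ultimately show ?thesis by (simp only:)
qed

text \<open>Testing \<open>f\<close> against polynomials that tend boundedly to the conjugate of \<open>sgn f\<close> gives \<open>\<integral>\<bar>f\<bar> = 0\<close>.\<close>
lemma null_coeffs_AE_zero:
  assumes "null_coeffs f"
  shows "AE x in Lpi. f x = 0"
proof -
  have f: "integrable Lpi f" using assms by (simp add: null_coeffs_def)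
  then have [measurable]: "f \<in> borel_measurable Lpi" by auto
  define h where "h x = cnj (sgn (f x))" for x
  have h: "h \<in> borel_measurable Lpi"
    unfolding h_def[abs_def] sgn_div_norm
    by (intro borel_measurable_continuous_on[where f=cnj] continuous_intros) measurable
  have h_le: "cmod (h x) \<le> 1" for x by (simp add: h_def norm_sgn)
  obtain p where p: "\<And>n. polynomial_function (p n)" "\<And>n x. cmod (p n (cis x)) \<le> 2"
      "AE x in Lpi. (\<lambda>n. p n (cis x)) \<longlonglongrightarrow> h x"
    using circle_polynomials_approximate_measurable[OF h h_le] by blast
  have p_meas: "(\<lambda>x. p n (cis x)) \<in> borel_measurable Lpi" for n
    by (intro measurable_lebesgue_on_pi continuous_intros
        continuous_on_compose2[OF continuous_on_polymonial_function[OF p(1)], of UNIV])  auto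
  have "(\<lambda>n. LINT x|Lpi. f x * p n (cis x)) \<longlonglongrightarrow> (LINT x|Lpi. f x * h x)"
  proof (rule integral_dominated_convergence[where w="\<lambda>x. 2 * cmod (f x)"])
    show "(\<lambda>x. f x * h x) \<in> borel_measurable Lpi" using h by measurable
    show "(\<lambda>x. f x * p n (cis x)) \<in> borel_measurable Lpi" for n using p_meas[of n] by measurable
    show "AE x in Lpi. (\<lambda>n. f x * p n (cis x)) \<longlonglongrightarrow> f x * h x"
      using p(3) by eventually_elim (intro tendsto_intros)
    show "AE x in Lpi. cmod (f x * p n (cis x)) \<le> 2 * cmod (f x)" for n
      by (rule AE_I2) (simp add: norm_mult mult.commute[of "cmod (f _)"] p(2) mult_right_mono)
  qed (use f in auto)
  moreover have "(LINT x|Lpi. f x * p n (cis x)) = 0" for n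
    using null_coeffs_mult_complex_polynomial[OF p(1)[of n] assms]
    unfolding null_coeffs_def by (metis (no_types, lifting) ext fourier_mode_0 mult.right_neutral)
  ultimately have "(LINT x|Lpi. f x * h x) = 0"
    by (simp add: LIMSEQ_const_iff)
  moreover have "f x * h x = of_real (cmod (f x))" for x
    using complex_norm_square[of "f x"]
    by (cases "f x = 0") (simp_all add: h_def sgn_eq power2_eq_square nonzero_divide_eq_eq flip: of_real_mult)
  ultimately have "(LINT x|Lpi. cmod (f x)) = 0" by simp
  then show ?thesis
    using f by (subst (asm) integral_nonneg_eq_0_iff_AE) auto
qed

section \<open>Truncated Fourier series\<close>

text \<open>The index set is arbitrary, so that the difference of two truncations is again of this
  form, over the difference of their index sets.\<close>

definition trig_poly :: "int set \<Rightarrow> (int \<Rightarrow> complex) \<Rightarrow> real \<Rightarrow> complex" where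
  "trig_poly K c x = (\<Sum>k\<in>K. c k * fourier_mode k x)"

lemma trig_proj_eq: "trig_proj N f = trig_poly {-int N..int N} (fourier_coeff f)"
  by (simp add: trig_proj_def trig_poly_def fun_eq_iff)

lemma continuous_on_trig_poly [continuous_intros]: "continuous_on S (trig_poly K c)"
  unfolding trig_poly_def[abs_def] by (intro continuous_intros)

lemma trig_poly_measurable [measurable]: "trig_poly K c \<in> borel_measurable Lpi"
  by (intro measurable_lebesgue_on_pi continuous_intros)

lemma norm_trig_poly_le: "cmod (trig_poly K c x) \<le> (\<Sum>k\<in>K. cmod (c k))"
  unfolding trig_poly_def by (rule order_trans[OF norm_sum]) (simp add: norm_mult)

lemma integrable_trig_poly: "integrable Lpi (trig_poly K c)"
  by (rule integrable_bounded_Lpi[where B="\<Sum>k\<in>K. cmod (c k)"]) (auto intro: norm_trig_poly_le)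

lemma fourier_coeff_integral:
  "(LINT x|Lpi. f x * fourier_mode k x) = 2 * of_real pi * fourier_coeff f (- k)"
  by (simp add: fourier_coeff_def)

lemma fourier_coeff_AE_cong:
  assumes "AE x in Lpi. f x = g x" "f \<in> borel_measurable Lpi" "g \<in> borel_measurable Lpi"
  shows "fourier_coeff f k = fourier_coeff g k"
  unfolding fourier_coeff_def using assms
  by (intro arg_cong2[where f="(*)"] refl integral_cong_AE) auto

lemma fourier_coeff_trig_poly:
  assumes "finite K"
  shows "fourier_coeff (trig_poly K c) k = (if k \<in> K then c k else 0)"
proof -
  have "(LINT x|Lpi. trig_poly K c x * fourier_mode (- k) x)
      = (LINT x|Lpi. (\<Sum>j\<in>K. c j * fourier_mode (j - k) x))"
    by (simp add: trig_poly_def sum_distrib_right mult.assoc fourier_mode_mult)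
  also have "\<dots> = (\<Sum>j\<in>K. c j * (if j = k then 2 * of_real pi else 0))"
    by (subst Bochner_Integration.integral_sum) (auto simp: integral_fourier_mode intro!: sum.cong)
  also have "\<dots> = 2 * of_real pi * (if k \<in> K then c k else 0)"
    using assms by (simp add: if_distrib cong: if_cong)
  finally show ?thesis by (simp add: fourier_coeff_def)
qed

text \<open>Parseval's relation with one polynomial factor. It yields Parseval for polynomials, mass
  conservation and the estimate of the nonlinear term.\<close>

lemma integral_mult_cnj_trig_poly:
  assumes "integrable Lpi f"
  shows "(LINT x|Lpi. f x * cnj (trig_poly K a x)) = 2 * of_real pi * (\<Sum>k\<in>K. fourier_coeff f k * cnj (a k))"
proof -
  have "(LINT x|Lpi. f x * cnj (trig_poly K a x))
      = (LINT x|Lpi. (\<Sum>k\<in>K. cnj (a k) * (f x * fourier_mode (- k) x)))"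
    by (simp add: trig_poly_def sum_distrib_left cnj_fourier_mode mult_ac)
  also have "\<dots> = (\<Sum>k\<in>K. cnj (a k) * (2 * of_real pi * fourier_coeff f k))"
    using assms by (subst Bochner_Integration.integral_sum)
      (auto intro!: integrable_mult_mode simp: fourier_coeff_integral)
  finally show ?thesis by (simp add: sum_distrib_left mult_ac)
qed

lemma parseval_trig_poly:
  assumes "finite K"
  shows "(LINT x|Lpi. (cmod (trig_poly K a x))\<^sup>2) = 2 * pi * (\<Sum>k\<in>K. (cmod (a k))\<^sup>2)"
proof -
  have "of_real (LINT x|Lpi. (cmod (trig_poly K a x))\<^sup>2) = (LINT x|Lpi. trig_poly K a x * cnj (trig_poly K a x))"
    by (simp only: integral_complex_of_real[symmetric] complex_norm_square)
  also have "\<dots> = 2 * of_real pi * (\<Sum>k\<in>K. a k * cnj (a k))"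
    by (subst integral_mult_cnj_trig_poly[OF integrable_trig_poly])
       (simp add: fourier_coeff_trig_poly[OF assms])
  also have "\<dots> = of_real (2 * pi * (\<Sum>k\<in>K. (cmod (a k))\<^sup>2))"
    by (simp only: complex_norm_square of_real_mult of_real_sum of_real_numeral)
  finally show ?thesis by (simp only: of_real_eq_iff)
qed

lemma integrable_norm_square_trig_poly: "integrable Lpi (\<lambda>x. (cmod (trig_poly K c x))\<^sup>2)"
proof (rule finite_measure.integrable_const_bound[OF finite_measure_Lpi])
  show "AE x in Lpi. norm ((cmod (trig_poly K c x))\<^sup>2) \<le> (\<Sum>k\<in>K. cmod (c k))\<^sup>2"
    unfolding real_norm_def abs_power2 by (intro AE_I2 power_mono norm_trig_poly_le norm_ge_zero)
qed simp

lemma integrable_truncation_error: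
  assumes "f \<in> borel_measurable Lpi" "AE x in Lpi. cmod (f x) \<le> R"
  shows "integrable Lpi (\<lambda>x. (cmod (f x - trig_proj N f x))\<^sup>2)"
proof (rule finite_measure.integrable_const_bound[OF finite_measure_Lpi])
  show "AE x in Lpi. norm ((cmod (f x - trig_proj N f x))\<^sup>2)
      \<le> (R + (\<Sum>k\<in>{-int N..int N}. cmod (fourier_coeff f k)))\<^sup>2"
    using assms(2) unfolding trig_proj_eq real_norm_def abs_power2
    by eventually_elim (intro power_mono order_trans[OF norm_triangle_ineq4] add_mono norm_trig_poly_le norm_ge_zero)
qed (use assms(1) in \<open>simp add: trig_proj_eq\<close>)

section \<open>Sobolev bounds, pointwise convergence and truncation errors\<close>

text \<open>Comparison with n^(-2s) on each half of the integers; convergence there is exactly where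
  s > 1/2 enters.\<close>

lemma summable_on_int_weight:
  assumes "1 / 2 < s"
  shows "(\<lambda>k::int. (1 + (real_of_int k)\<^sup>2) powr (- s)) summable_on UNIV"
proof -
  have "summable (\<lambda>n. real n powr (- (2 * s)))"
    using assms by (simp add: summable_real_powr_iff)
  then have sn: "summable (\<lambda>n. norm ((1 + (real n)\<^sup>2) powr (- s)))"
  proof (rule summable_comparison_test[rotated], intro exI allI impI)
    fix n :: nat assume n: "1 \<le> n"
    have "(1 + (real n)\<^sup>2) powr (- s) \<le> ((real n)\<^sup>2) powr (- s)"
      using n assms by (intro powr_mono2') auto
    also have "\<dots> = real n powr (- (2 * s))"
    proof -
      have "(real n)\<^sup>2 = real n powr 2" using n by simp
      then show ?thesis by (simp only: powr_powr) simp
    qed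
    finally show "norm (norm ((1 + (real n)\<^sup>2) powr (- s))) \<le> real n powr (- (2 * s))" by simp
  qed
  have 1: "(\<lambda>n. (1 + (real n)\<^sup>2) powr (- s)) summable_on UNIV"
    using sn by (rule norm_summable_imp_summable_on)
  have r: "range int \<union> range (\<lambda>n. - int n) = UNIV"
  proof -
    have "k \<in> range int \<union> range (\<lambda>n. - int n)" for k
      by (cases k rule: int_cases2) auto
    then show ?thesis by blast
  qed
  have "(\<lambda>k::int. (1 + (real_of_int k)\<^sup>2) powr (- s)) summable_on (range int)"
    using 1 by (subst summable_on_reindex) (auto simp: o_def)
  moreover have "(\<lambda>k::int. (1 + (real_of_int k)\<^sup>2) powr (- s)) summable_on (range (\<lambda>n. - int n))"
    using 1 by (subst summable_on_reindex) (auto simp: o_def inj_on_def)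
  ultimately have "(\<lambda>k::int. (1 + (real_of_int k)\<^sup>2) powr (- s)) summable_on (range int \<union> range (\<lambda>n. - int n))"
    by (rule summable_on_union)
  then show ?thesis by (simp only: r)
qed

lemma sobolev_finite_sum_le:
  assumes "f \<in> sobolev_space s" "sobolev_norm s f \<le> B" "finite K"
  shows "(\<Sum>k\<in>K. (1 + (real_of_int k)\<^sup>2) powr s * (cmod (fourier_coeff f k))\<^sup>2) \<le> B\<^sup>2"
proof -
  let ?S = "\<Sum>\<^sub>\<infinity>k::int. (1 + (real_of_int k)\<^sup>2) powr s * (cmod (fourier_coeff f k))\<^sup>2"
  have "(\<Sum>k\<in>K. (1 + (real_of_int k)\<^sup>2) powr s * (cmod (fourier_coeff f k))\<^sup>2) \<le> ?S"
    using assms by (intro finite_sum_le_infsum) (auto simp: sobolev_space_def)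
  moreover have "?S \<ge> 0" by (intro infsum_nonneg) auto
  ultimately show ?thesis
    using assms(2) real_sqrt_le_iff[of ?S "B\<^sup>2"] unfolding sobolev_norm_def
    by (smt (verit) real_sqrt_ge_zero real_sqrt_pow2 power_mono)
qed

text \<open>Quantitative form of the embedding of H^s into absolutely convergent Fourier series.
  With w = (1+k^2)^(s/2), the inequality 2ab \<le> a^2 + b^2 is applied to a = 1/w and b = w times
  the modulus of the coefficient, which explains the additive bound.\<close>

lemma sobolev_sum_coeffs_le:
  assumes "1 / 2 < s" "f \<in> sobolev_space s" "sobolev_norm s f \<le> B" "finite K"
  shows "(\<Sum>k\<in>K. cmod (fourier_coeff f k))
      \<le> ((\<Sum>\<^sub>\<infinity>k::int. (1 + (real_of_int k)\<^sup>2) powr (- s)) + B\<^sup>2) / 2"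
proof -
  have "cmod (fourier_coeff f k) \<le> ((1 + (real_of_int k)\<^sup>2) powr (- s)
      + (1 + (real_of_int k)\<^sup>2) powr s * (cmod (fourier_coeff f k))\<^sup>2) / 2" for k
  proof -
    define w where "w = (1 + (real_of_int k)\<^sup>2) powr (s / 2)"
    have nz: "1 + (real_of_int k)\<^sup>2 \<noteq> 0" by (smt (verit) zero_le_power2)
    then have w: "w > 0" unfolding w_def by simp
    have "(1 + (real_of_int k)\<^sup>2) powr s = w\<^sup>2" "(1 + (real_of_int k)\<^sup>2) powr (- s) = (1 / w)\<^sup>2"
      using nz unfolding w_def by (simp_all add: powr_minus power2_eq_square inverse_eq_divide flip: powr_add)
    moreover have "2 * (1 / w) * (w * cmod (fourier_coeff f k)) \<le> (1 / w)\<^sup>2 + (w * cmod (fourier_coeff f k))\<^sup>2"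
      by (rule sum_squares_bound)
    ultimately show ?thesis using w by (simp add: power_mult_distrib)
  qed
  then have "(\<Sum>k\<in>K. cmod (fourier_coeff f k)) \<le> (\<Sum>k\<in>K. ((1 + (real_of_int k)\<^sup>2) powr (- s)
      + (1 + (real_of_int k)\<^sup>2) powr s * (cmod (fourier_coeff f k))\<^sup>2) / 2)"
    by (rule sum_mono)
  also have "\<dots> = ((\<Sum>k\<in>K. (1 + (real_of_int k)\<^sup>2) powr (- s))
      + (\<Sum>k\<in>K. (1 + (real_of_int k)\<^sup>2) powr s * (cmod (fourier_coeff f k))\<^sup>2)) / 2"
    by (simp add: sum_divide_distrib[symmetric] sum.distrib)
  also have "\<dots> \<le> ((\<Sum>\<^sub>\<infinity>k::int. (1 + (real_of_int k)\<^sup>2) powr (- s)) + B\<^sup>2) / 2"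
    by (intro divide_right_mono add_mono sobolev_finite_sum_le[OF assms(2-4)]
         finite_sum_le_infsum summable_on_int_weight assms) auto
  finally show ?thesis .
qed

text \<open>The interval has finite measure and |f| \<le> 1 + |f|^2.\<close>

lemma L2_per_integrable:
  assumes "f \<in> L2_per" shows "integrable Lpi f"
proof -
  have "integrable Lpi (\<lambda>x. 1 + (cmod (f x))\<^sup>2)"
    using assms finite_measure.integrable_const[OF finite_measure_Lpi, of "1::real"]
    by (intro Bochner_Integration.integrable_add) (auto simp: L2_per_def)
  then show ?thesis
  proof (rule Bochner_Integration.integrable_bound)
    show "AE x in Lpi. norm (f x) \<le> norm (1 + (cmod (f x))\<^sup>2)"
    proof (rule AE_I2)
      fix x
      have "2 * cmod (f x) \<le> 1 + (cmod (f x))\<^sup>2" using sum_squares_bound[of 1 "cmod (f x)"] by simp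
      then have "cmod (f x) \<le> 1 + (cmod (f x))\<^sup>2" using norm_ge_zero[of "f x"] by linarith
      then show "norm (f x) \<le> norm (1 + (cmod (f x))\<^sup>2)"
        by (simp del: power2_norm_eq_inner)
    qed
  qed (use assms in \<open>simp add: L2_per_def\<close>)
qed

text \<open>Turns the unordered convergence expressed by \<open>has_sum\<close> into convergence of
  the symmetric partial sums \<open>trig_proj M f\<close>.\<close>

lemma filterlim_symmetric_intervals:
  "filterlim (\<lambda>M. {-int M..int M}) (finite_subsets_at_top UNIV) sequentially"
  unfolding filterlim_finite_subsets_at_top
proof (intro allI impI)
  fix X :: "int set" assume "finite X \<and> X \<subseteq> UNIV"
  then obtain b where b: "\<And>k. k \<in> X \<Longrightarrow> \<bar>k\<bar> \<le> b"
    using finite_imageI[of X abs] by (metis Max_ge image_eqI)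
  show "\<forall>\<^sub>F M in sequentially. finite {-int M..int M} \<and> X \<subseteq> {-int M..int M} \<and> {-int M..int M} \<subseteq> UNIV"
    by (rule eventually_sequentiallyI[of "nat b"]) (use b in fastforce)
qed

text \<open>The sum g of the series is a bounded limit of the truncations, hence has the same
  coefficients as f by dominated convergence, and uniqueness gives g = f almost everywhere. This
  later yields both the sup bound on the exact solution and the limit in the truncation
  error.\<close>

lemma absolutely_summable_coeffs_imp_series_converges:
  assumes f: "integrable Lpi f"
    and bound: "\<And>K. finite K \<Longrightarrow> (\<Sum>k\<in>K. cmod (fourier_coeff f k)) \<le> M0"
  shows "AE x in Lpi. (\<lambda>M. trig_proj M f x) \<longlonglongrightarrow> f x"
proof -
  have "(\<lambda>k. cmod (fourier_coeff f k)) summable_on UNIV"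
    by (intro nonneg_bdd_above_summable_on bdd_aboveI2[where M=M0] bound) auto
  then have "(\<lambda>k. norm (fourier_coeff f k * fourier_mode k x)) summable_on UNIV" for x
    by (simp add: norm_mult)
  then have "(\<lambda>k. fourier_coeff f k * fourier_mode k x) summable_on UNIV" for x
    by (rule abs_summable_summable)
  then have hs: "((\<lambda>k. fourier_coeff f k * fourier_mode k x) has_sum
      (\<Sum>\<^sub>\<infinity>k. fourier_coeff f k * fourier_mode k x)) UNIV" for x
    by (rule has_sum_infsum)
  define g where "g x = (\<Sum>\<^sub>\<infinity>k. fourier_coeff f k * fourier_mode k x)" for x
  have lim: "(\<lambda>M. trig_proj M f x) \<longlonglongrightarrow> g x" for x
    using filterlim_compose[OF hs[of x, unfolded has_sum_def] filterlim_symmetric_intervals]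
    by (simp add: g_def trig_proj_def)
  have proj_meas: "trig_proj M f \<in> borel_measurable Lpi" for M
    by (simp add: trig_proj_eq trig_poly_measurable)
  have proj_le: "cmod (trig_proj M f x) \<le> M0" for M x
    unfolding trig_proj_eq by (rule order_trans[OF norm_trig_poly_le bound]) simp
  have g_meas: "g \<in> borel_measurable Lpi"
    by (rule borel_measurable_LIMSEQ_metric[OF proj_meas lim])
  have g_le: "cmod (g x) \<le> M0" for x
    by (rule tendsto_upperbound[OF tendsto_norm[OF lim]]) (simp_all add: proj_le)
  have g_int: "integrable Lpi g"
    by (rule integrable_bounded_Lpi[OF g_meas, of M0]) (simp add: g_le)
  have "null_coeffs (\<lambda>x. 1 * f x + (- 1) * g x)"
    unfolding null_coeffs_def
  proof (intro conjI allI)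
    show "integrable Lpi (\<lambda>x. 1 * f x + (- 1) * g x)" using f g_int by auto
    fix k
    have lim_coeff: "(\<lambda>M. LINT x|Lpi. trig_proj M f x * fourier_mode k x) \<longlonglongrightarrow> (LINT x|Lpi. g x * fourier_mode k x)"
    proof (rule integral_dominated_convergence[where w="\<lambda>_. M0"])
      show "integrable Lpi (\<lambda>_. M0)"
        by (rule finite_measure.integrable_const[OF finite_measure_Lpi])
      show "AE x in Lpi. (\<lambda>M. trig_proj M f x * fourier_mode k x) \<longlonglongrightarrow> g x * fourier_mode k x"
        by (intro AE_I2 tendsto_intros lim)
      show "AE x in Lpi. cmod (trig_proj M f x * fourier_mode k x) \<le> M0" for M
        by (simp add: norm_mult proj_le)
    qed (intro borel_measurable_times g_meas proj_meas fourier_mode_measurable)+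
    \<comment> \<open>As soon as M \<ge> |k|, the truncation has the same coefficient as
      \<open>f\<close>, so the sequence of integrals is eventually constant.\<close>
    have "\<forall>\<^sub>F M in sequentially. (LINT x|Lpi. trig_proj M f x * fourier_mode k x)
        = (LINT x|Lpi. f x * fourier_mode k x)"
      by (rule eventually_sequentiallyI[of "nat \<bar>k\<bar>"])
         (auto simp: fourier_coeff_integral trig_proj_eq fourier_coeff_trig_poly)
    then have "(LINT x|Lpi. f x * fourier_mode k x) = (LINT x|Lpi. g x * fourier_mode k x)"
      by (rule LIMSEQ_unique[OF tendsto_eventually lim_coeff])
    then show "(LINT x|Lpi. (1 * f x + (- 1) * g x) * fourier_mode k x) = 0"
      using integrable_mult_mode[OF f, of k] integrable_mult_mode[OF g_int, of k]
      by (simp add: left_diff_distrib)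
  qed
  then have "AE x in Lpi. 1 * f x + (- 1) * g x = 0" by (rule null_coeffs_AE_zero)
  then show ?thesis
  proof eventually_elim
    case (elim x)
    then have "f x = g x" by simp
    then show ?case using lim[of x] by simp
  qed
qed

lemma trig_poly_diff_subset:
  assumes "finite K" "L \<subseteq> K"
  shows "trig_poly K c x - trig_poly L c x = trig_poly (K - L) c x"
  using assms by (simp add: trig_poly_def sum_diff)

text \<open>By Parseval the squared distance between the truncations at M \<ge> N and at N is a
  finite tail sum; all its indices exceed N in modulus, so the weight there is at least N^(2\<mu>).
  Then M tends to infinity. The dominating constant comes from \<open>M0\<close>, a bound separate
  from the H^\<mu> norm, since \<mu> may be 1/2 or less.\<close>

lemma L2_truncation_error:
  assumes f: "f \<in> sobolev_space \<mu>" "sobolev_norm \<mu> f \<le> B" and "0 < \<mu>" "1 \<le> N"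
    and bound: "\<And>K. finite K \<Longrightarrow> (\<Sum>k\<in>K. cmod (fourier_coeff f k)) \<le> M0"
  shows "(LINT x|Lpi. (cmod (f x - trig_proj N f x))\<^sup>2) \<le> 2 * pi * (B * real N powr (- \<mu>))\<^sup>2"
proof -
  let ?I = "\<lambda>M. {-int M..int M}"
  have fi: "integrable Lpi f" using f L2_per_integrable by (simp add: sobolev_space_def)
  then have [measurable]: "f \<in> borel_measurable Lpi" by auto
  have [measurable]: "trig_proj M f \<in> borel_measurable Lpi" for M
    by (simp add: trig_proj_eq trig_poly_measurable)
  have proj_le: "cmod (trig_proj M f x) \<le> M0" for M x
    unfolding trig_proj_eq by (rule order_trans[OF norm_trig_poly_le bound]) simp
  have "(\<lambda>M. LINT x|Lpi. (cmod (trig_proj M f x - trig_proj N f x))\<^sup>2)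
      \<longlonglongrightarrow> (LINT x|Lpi. (cmod (f x - trig_proj N f x))\<^sup>2)"
  proof (rule integral_dominated_convergence[where w="\<lambda>_. (M0 + M0)\<^sup>2"])
    show "integrable Lpi (\<lambda>_. (M0 + M0)\<^sup>2)"
      by (rule finite_measure.integrable_const[OF finite_measure_Lpi])
    have "AE x in Lpi. (\<lambda>M. trig_proj M f x) \<longlonglongrightarrow> f x"
      by (rule absolutely_summable_coeffs_imp_series_converges[OF fi bound])
    then show "AE x in Lpi. (\<lambda>M. (cmod (trig_proj M f x - trig_proj N f x))\<^sup>2)
        \<longlonglongrightarrow> (cmod (f x - trig_proj N f x))\<^sup>2"
      by eventually_elim (intro tendsto_intros)
    show "AE x in Lpi. norm ((cmod (trig_proj M f x - trig_proj N f x))\<^sup>2) \<le> (M0 + M0)\<^sup>2" for M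
      unfolding real_norm_def abs_power2
      by (intro AE_I2 power_mono order_trans[OF norm_triangle_ineq4] add_mono proj_le norm_ge_zero)
  qed measurable
  moreover have "(LINT x|Lpi. (cmod (trig_proj M f x - trig_proj N f x))\<^sup>2)
      \<le> 2 * pi * (B * real N powr (- \<mu>))\<^sup>2" if "M \<ge> N" for M
  proof -
    have "(LINT x|Lpi. (cmod (trig_proj M f x - trig_proj N f x))\<^sup>2)
        = 2 * pi * (\<Sum>k\<in>?I M - ?I N. (cmod (fourier_coeff f k))\<^sup>2)"
      using that by (simp add: trig_proj_eq trig_poly_diff_subset parseval_trig_poly)
    also have "\<dots> \<le> 2 * pi * (\<Sum>k\<in>?I M - ?I N. (real N powr (- \<mu>))\<^sup>2 *
        ((1 + (real_of_int k)\<^sup>2) powr \<mu> * (cmod (fourier_coeff f k))\<^sup>2))"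
    proof (intro mult_left_mono sum_mono)
      fix k assume "k \<in> ?I M - ?I N"
      then have "real N \<le> \<bar>real_of_int k\<bar>" by auto
      then have "(real N)\<^sup>2 \<le> 1 + (real_of_int k)\<^sup>2"
        using abs_le_square_iff[of "real N" "real_of_int k"] by simp
      then have "((real N)\<^sup>2) powr \<mu> \<le> (1 + (real_of_int k)\<^sup>2) powr \<mu>"
        using assms by (intro powr_mono2) auto
      moreover have "((real N)\<^sup>2) powr \<mu> = 1 / (real N powr (- \<mu>))\<^sup>2"
        using assms by (simp add: powr_powr powr_minus field_simps power2_eq_square powr_mult)
      moreover have "(real N powr (- \<mu>))\<^sup>2 > 0" using assms by simp
      ultimately have "1 \<le> (real N powr (- \<mu>))\<^sup>2 * (1 + (real_of_int k)\<^sup>2) powr \<mu>"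
        by (simp add: field_simps)
      from mult_right_mono[OF this, of "(cmod (fourier_coeff f k))\<^sup>2"]
      show "(cmod (fourier_coeff f k))\<^sup>2 \<le> (real N powr (- \<mu>))\<^sup>2 *
        ((1 + (real_of_int k)\<^sup>2) powr \<mu> * (cmod (fourier_coeff f k))\<^sup>2)"
        by (simp add: mult.assoc)
    qed simp
    also have "\<dots> \<le> 2 * pi * ((real N powr (- \<mu>))\<^sup>2 * B\<^sup>2)"
      unfolding sum_distrib_left[symmetric]
      by (intro mult_left_mono sobolev_finite_sum_le[OF f]) auto
    finally show ?thesis by (simp add: power_mult_distrib mult_ac)
  qed
  ultimately show ?thesis
    by (intro tendsto_upperbound[where F=sequentially]) (auto intro: eventually_sequentiallyI)
qed

section \<open>The semidiscrete equation\<close>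

text \<open>A geometric sum of powers of an n-th root of unity, which differs from 1 because |m| < n
  keeps n from dividing a nonzero m.\<close>

lemma sum_fourier_mode_nodes:
  fixes n :: nat and m :: int
  assumes "\<bar>m\<bar> < int n"
  shows "(\<Sum>j<n. fourier_mode m (2 * pi * real j / real n)) = (if m = 0 then of_nat n else 0)"
proof (cases "m = 0")
  case True
  then show ?thesis by simp
next
  case False
  define z where "z = cis (2 * pi * of_int m / real n)"
  have n: "n > 0" using assms by (cases n) auto
  have pow: "fourier_mode m (2 * pi * real j / real n) = z ^ j" for j
    by (simp add: z_def fourier_mode_cis Complex.DeMoivre mult_ac)
  have "z ^ n = cis (2 * pi * of_int m)"
    using n by (simp add: z_def Complex.DeMoivre)
  then have "z ^ n = 1" by (simp add: cis_multiple_2pi)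
  moreover have "z \<noteq> 1"
  proof
    assume "z = 1"
    then have "cos (2 * pi * of_int m / real n) = 1" unfolding z_def by (metis cis.sel(1) one_complex.sel(1))
    then obtain i :: int where "2 * pi * of_int m / real n = of_int i * 2 * pi"
      by (auto simp: cos_one_2pi_int)
    then have "real_of_int m = of_int (i * int n)" using n by (simp add: field_simps)
    then have "m = i * int n" by (simp only: of_int_eq_iff)
    then have "int n dvd \<bar>m\<bar>" by simp
    with assms False show False using zdvd_imp_le[of "int n" "\<bar>m\<bar>"] by auto
  qed
  ultimately show ?thesis
    using False by (simp add: pow geometric_sum)
qed

text \<open>Expressing the coefficients by finitely many point values transfers pointwise differentiability
  in time to the Fourier coefficients.\<close>
lemma discrete_fourier_inversion:
  assumes "k \<in> {-int N..int N}"
  shows "c k = (\<Sum>j<2 * N + 1. trig_poly {-int N..int N} c (2 * pi * real j / real (2 * N + 1))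
            * fourier_mode (- k) (2 * pi * real j / real (2 * N + 1))) / of_nat (2 * N + 1)"
proof -
  let ?x = "\<lambda>j. 2 * pi * real j / real (2 * N + 1)" and ?K = "{-int N..int N}"
  have "(\<Sum>j<2 * N + 1. trig_poly ?K c (?x j) * fourier_mode (- k) (?x j))
      = (\<Sum>j<2 * N + 1. \<Sum>l\<in>?K. c l * fourier_mode (l - k) (?x j))"
    by (simp add: trig_poly_def sum_distrib_right mult.assoc fourier_mode_mult)
  also have "\<dots> = (\<Sum>l\<in>?K. c l * (\<Sum>j<2 * N + 1. fourier_mode (l - k) (?x j)))"
    unfolding sum_distrib_left by (rule sum.swap)
  \<comment> \<open>Here |l - k| \<le> 2N, so 2N + 1 nodes are just enough to tell the modes
    apart.\<close>
  also have "\<dots> = (\<Sum>l\<in>?K. c l * (if l - k = 0 then of_nat (2 * N + 1) else 0))"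
    by (intro sum.cong refl arg_cong2[where f="(*)"] sum_fourier_mode_nodes) (use assms in auto)
  also have "\<dots> = (\<Sum>l\<in>?K. if l = k then c k * of_nat (2 * N + 1) else 0)"
    by (intro sum.cong) auto
  also have "\<dots> = c k * of_nat (2 * N + 1)"
    using assms by (subst sum.delta) auto
  finally show ?thesis by (simp del: of_nat_add of_nat_mult of_nat_Suc)
qed

lemma frac_lap_trig_poly:
  assumes "finite K"
  shows "frac_lap s (trig_poly K c) x = trig_poly K (\<lambda>k. of_real (frac_symbol s k) * c k) x"
proof -
  have "frac_lap s (trig_poly K c) x = (\<Sum>\<^sub>\<infinity>k\<in>K. of_real (frac_symbol s k) * c k * fourier_mode k x)"
    unfolding frac_lap_def by (rule infsum_cong_neutral) (auto simp: fourier_coeff_trig_poly[OF assms])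
  then show ?thesis using assms by (simp add: trig_poly_def)
qed

lemma trig_space_eq: "f \<in> trig_space N \<Longrightarrow> f = trig_poly {-int N..int N} (fourier_coeff f)"
  by (auto simp: trig_space_def trig_poly_def fourier_coeff_trig_poly[unfolded trig_poly_def[abs_def]])

text \<open>The projection only discards modes, so the retained coefficients of \<open>v\<close>
  satisfy equations of the same form as those of the exact solution and the two can be subtracted
  mode by mode.\<close>

lemma semidiscrete_coeff_derivative:
  assumes sol: "semidiscrete_solution s T N u0 v" and t: "t \<in> {0..T}" and k: "k \<in> {-int N..int N}"
  shows "((\<lambda>\<tau>. fourier_coeff (v \<tau>) k) has_vector_derivative
           (- \<i> * of_real (frac_symbol s k) * fourier_coeff (v t) k
              + \<i> * fourier_coeff (cubic (v t)) k)) (at t within {0..T})"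
proof -
  let ?x = "\<lambda>j. 2 * pi * real j / real (2 * N + 1)" and ?K = "{-int N..int N}"
  define d where "d k = - \<i> * of_real (frac_symbol s k) * fourier_coeff (v t) k
              + \<i> * fourier_coeff (cubic (v t)) k" for k
  have v: "v \<tau> = trig_poly ?K (fourier_coeff (v \<tau>))" if "\<tau> \<in> {0..T}" for \<tau>
    using sol that by (intro trig_space_eq) (simp add: semidiscrete_solution_def)
  have rhs: "semidiscrete_rhs s N (v t) x = trig_poly ?K d x" for x
    unfolding semidiscrete_rhs_def trig_proj_eq
    by (subst v[OF t], subst frac_lap_trig_poly)
       (simp_all add: trig_poly_def d_def sum_distrib_left sum.distrib[symmetric] algebra_simps
          flip: sum_negf sum_subtractf)
  have der: "((\<lambda>\<tau>. v \<tau> x) has_vector_derivative trig_poly ?K d x) (at t within {0..T})" for x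
    using sol t unfolding semidiscrete_solution_def rhs[symmetric] by blast
  have "((\<lambda>\<tau>. (\<Sum>j<2 * N + 1. v \<tau> (?x j) * fourier_mode (- k) (?x j)) / of_nat (2 * N + 1))
      has_vector_derivative (\<Sum>j<2 * N + 1. trig_poly ?K d (?x j) * fourier_mode (- k) (?x j)) / of_nat (2 * N + 1))
      (at t within {0..T})"
    by (intro has_vector_derivative_divide has_vector_derivative_sum has_vector_derivative_mult_left der)
  then have "((\<lambda>\<tau>. (\<Sum>j<2 * N + 1. v \<tau> (?x j) * fourier_mode (- k) (?x j)) / of_nat (2 * N + 1))
      has_vector_derivative d k) (at t within {0..T})"
    by (simp only: discrete_fourier_inversion[OF k, of d, symmetric])
  then have "((\<lambda>\<tau>. fourier_coeff (v \<tau>) k) has_vector_derivative d k) (at t within {0..T})"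
  proof (rule has_vector_derivative_transform[OF t, rotated])
    fix \<tau> assume \<tau>: "\<tau> \<in> {0..T}"
    show "fourier_coeff (v \<tau>) k = (\<Sum>j<2 * N + 1. v \<tau> (?x j) * fourier_mode (- k) (?x j)) / of_nat (2 * N + 1)"
      by (subst (2) v[OF \<tau>]) (rule discrete_fourier_inversion[OF k])
  qed
  then show ?thesis by (simp only: d_def)
qed

section \<open>Mass conservation and the estimate of the cubic term\<close>

lemma has_real_derivative_cmod_power2:
  assumes "(f has_vector_derivative f') (at t within S)"
  shows "((\<lambda>\<tau>. (cmod (f \<tau>))\<^sup>2) has_real_derivative 2 * Re (f' * cnj (f t))) (at t within S)"
proof -
  have "((\<lambda>\<tau>. Re (f \<tau>)) has_real_derivative Re f') (at t within S)"
       "((\<lambda>\<tau>. Im (f \<tau>)) has_real_derivative Im f') (at t within S)"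
    unfolding has_real_derivative_iff_has_vector_derivative
    by (intro bounded_linear.has_vector_derivative[OF bounded_linear_Re assms]
          bounded_linear.has_vector_derivative[OF bounded_linear_Im assms])+
  then show ?thesis unfolding cmod_power2
    by (auto intro!: derivative_eq_intros assms simp: algebra_simps)
qed

text \<open>The dispersive part of the equation is skew-adjoint and drops out.\<close>
lemma has_real_derivative_sum_cmod_power2:
  fixes e :: "'k \<Rightarrow> real \<Rightarrow> complex" and \<sigma> :: "'k \<Rightarrow> real"
  assumes "\<And>k. k \<in> K \<Longrightarrow> (e k has_vector_derivative (- \<i> * of_real (\<sigma> k) * e k t + \<i> * d k)) (at t within S)"
  shows "((\<lambda>\<tau>. \<Sum>k\<in>K. (cmod (e k \<tau>))\<^sup>2) has_real_derivative - 2 * Im (\<Sum>k\<in>K. d k * cnj (e k t))) (at t within S)"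
proof -
  have "((\<lambda>\<tau>. \<Sum>k\<in>K. (cmod (e k \<tau>))\<^sup>2) has_real_derivative
      (\<Sum>k\<in>K. 2 * Re ((- \<i> * of_real (\<sigma> k) * e k t + \<i> * d k) * cnj (e k t)))) (at t within S)"
    by (intro DERIV_sum has_real_derivative_cmod_power2 assms)
  moreover have "2 * Re ((- \<i> * of_real (\<sigma> k) * e k t + \<i> * d k) * cnj (e k t)) = - 2 * Im (d k * cnj (e k t))" for k
    by (simp add: algebra_simps)
  ultimately show ?thesis
    by (simp only: Im_sum sum_distrib_left)
qed

lemma integrable_cubic:
  assumes "f \<in> borel_measurable Lpi" "AE x in Lpi. cmod (f x) \<le> R"
  shows "integrable Lpi (cubic f)"
proof (rule integrable_bounded_Lpi[where B="R\<^sup>2 * R"])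
  show "cubic f \<in> borel_measurable Lpi"
    unfolding cubic_def[abs_def] using assms(1) by measurable
  show "AE x in Lpi. cmod (cubic f x) \<le> R\<^sup>2 * R"
    using assms(2)
  proof eventually_elim
    case (elim x)
    then have "0 \<le> R" using norm_ge_zero order_trans by blast
    with elim show ?case unfolding cubic_def norm_mult norm_of_real
      by (intro mult_mono) (auto intro: power_mono)
  qed
qed

lemma integrable_cubic_trig_poly: "integrable Lpi (cubic (trig_poly K c))"
  by (rule integrable_cubic[where R="\<Sum>k\<in>K. cmod (c k)"]) (auto intro: norm_trig_poly_le)

text \<open>Pairing the cubic term with the solution gives the integral of |v|^4, which is real,
  while only the imaginary part of the pairing enters the derivative.\<close>

lemma semidiscrete_mass_conservation:
  assumes sol: "semidiscrete_solution s T N u0 v" and t: "t \<in> {0..T}"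
  shows "(\<Sum>k\<in>{-int N..int N}. (cmod (fourier_coeff (v t) k))\<^sup>2)
       = (\<Sum>k\<in>{-int N..int N}. (cmod (fourier_coeff (v 0) k))\<^sup>2)"
proof -
  let ?K = "{-int N..int N}"
  have der: "((\<lambda>\<tau>. \<Sum>k\<in>?K. (cmod (fourier_coeff (v \<tau>) k))\<^sup>2) has_real_derivative 0) (at r within {0..T})"
    if r: "r \<in> {0..T}" for r
  proof -
    have v: "v r = trig_poly ?K (fourier_coeff (v r))"
      using sol r by (intro trig_space_eq) (simp add: semidiscrete_solution_def)
    have "2 * of_real pi * (\<Sum>k\<in>?K. fourier_coeff (cubic (v r)) k * cnj (fourier_coeff (v r) k))
        = (LINT x|Lpi. cubic (v r) x * cnj (trig_poly ?K (fourier_coeff (v r)) x))"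
      by (rule integral_mult_cnj_trig_poly[symmetric]) (subst v, rule integrable_cubic_trig_poly)
    also have "\<dots> = (LINT x|Lpi. of_real ((cmod (v r x))\<^sup>2 * (cmod (v r x))\<^sup>2))"
      by (simp only: v[symmetric] cubic_def of_real_mult complex_norm_square mult.assoc)
    also have "\<dots> = of_real (LINT x|Lpi. (cmod (v r x))\<^sup>2 * (cmod (v r x))\<^sup>2)"
      by (rule integral_complex_of_real)
    finally have "(\<Sum>k\<in>?K. fourier_coeff (cubic (v r)) k * cnj (fourier_coeff (v r) k))
        = of_real ((LINT x|Lpi. (cmod (v r x))\<^sup>2 * (cmod (v r x))\<^sup>2) / (2 * pi))"
      by (simp add: eq_divide_eq mult.commute)
    then have "Im (\<Sum>k\<in>?K. fourier_coeff (cubic (v r)) k * cnj (fourier_coeff (v r) k)) = 0"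
      by (simp only: Im_complex_of_real)
    with has_real_derivative_sum_cmod_power2[of ?K "\<lambda>k \<tau>. fourier_coeff (v \<tau>) k" "frac_symbol s" r
        "fourier_coeff (cubic (v r))", OF semidiscrete_coeff_derivative[OF sol r]]
    show ?thesis by (simp only: mult_zero_right)
  qed
  have "\<exists>c. \<forall>r\<in>{0..T}. (\<Sum>k\<in>?K. (cmod (fourier_coeff (v r) k))\<^sup>2) = c"
    by (rule has_field_derivative_zero_constant[OF _ der]) auto
  then obtain c where "\<And>r. r \<in> {0..T} \<Longrightarrow> (\<Sum>k\<in>?K. (cmod (fourier_coeff (v r) k))\<^sup>2) = c"
    by blast
  then show ?thesis using t by simp
qed

text \<open>From |a|^2 a - |b|^2 b = |a|^2 (a - b) + (|a| - |b|)(|a| + |b|) b; the two terms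
  contribute R^2 and 2R^2.\<close>

lemma cubic_lipschitz:
  assumes "cmod a \<le> R" "cmod b \<le> R"
  shows "cmod (of_real ((cmod a)\<^sup>2) * a - of_real ((cmod b)\<^sup>2) * b) \<le> 3 * R\<^sup>2 * cmod (a - b)"
proof -
  have R: "0 \<le> R" using assms(1) norm_ge_zero order_trans by blast
  have "of_real ((cmod a)\<^sup>2) * a - of_real ((cmod b)\<^sup>2) * b
      = of_real ((cmod a)\<^sup>2) * (a - b) + of_real ((cmod a - cmod b) * (cmod a + cmod b)) * b"
    by (simp add: algebra_simps power2_eq_square)
  then have "cmod (of_real ((cmod a)\<^sup>2) * a - of_real ((cmod b)\<^sup>2) * b)
      \<le> (cmod a)\<^sup>2 * cmod (a - b) + \<bar>cmod a - cmod b\<bar> * (cmod a + cmod b) * cmod b"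
    by (metis (no_types, lifting) norm_triangle_ineq norm_mult norm_of_real abs_mult abs_of_nonneg
        add_nonneg_nonneg norm_ge_zero zero_le_power2)
  also have "\<dots> \<le> R\<^sup>2 * cmod (a - b) + cmod (a - b) * (R + R) * R"
    using assms R by (intro add_mono mult_mono norm_triangle_ineq3 power_mono mult_nonneg_nonneg) auto
  finally show ?thesis by (simp add: power2_eq_square algebra_simps)
qed

text \<open>Up to the factor 2 pi the sum is the integral of the difference of the cubic terms
  against the conjugate of E = P_N u - v. Splitting u - v into the truncation error, of modulus p,
  and E, of modulus q, leaves pq + q^2 \<le> (3/2) q^2 + (1/2) p^2. Doubled, the bound reads 9R^2 (y
  + \<delta>^2/3) with y the sum of |e_k|^2, ready for Gronwall.\<close>

lemma nonlinear_term_bound: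
  fixes N :: nat and c :: "int \<Rightarrow> complex" and u :: "real \<Rightarrow> complex"
  defines "K \<equiv> {-int N..int N}"
  defines "e \<equiv> \<lambda>k. fourier_coeff u k - c k"
  assumes u: "u \<in> borel_measurable Lpi" and u_le: "AE x in Lpi. cmod (u x) \<le> R"
    and v_le: "\<And>x. cmod (trig_poly K c x) \<le> R"
    and trunc: "(LINT x|Lpi. (cmod (u x - trig_proj N u x))\<^sup>2) \<le> 2 * pi * \<delta>\<^sup>2"
  shows "cmod (\<Sum>k\<in>K. (fourier_coeff (cubic u) k - fourier_coeff (cubic (trig_poly K c)) k) * cnj (e k))
      \<le> R\<^sup>2 / 2 * (9 * (\<Sum>k\<in>K. (cmod (e k))\<^sup>2) + 3 * \<delta>\<^sup>2)"
proof -
  let ?v = "trig_poly K c" and ?E = "trig_poly K e"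
  have K: "finite K" by (simp add: K_def)
  have iu: "integrable Lpi (cubic u)" by (rule integrable_cubic[OF u u_le])
  have iv: "integrable Lpi (cubic ?v)" by (rule integrable_cubic_trig_poly)
  have P: "trig_proj N u = trig_poly K (fourier_coeff u)" by (simp add: trig_proj_eq K_def)
  have E: "?E x = trig_proj N u x - ?v x" for x
    by (simp add: P trig_poly_def e_def left_diff_distrib sum_subtractf)
  have iP: "integrable Lpi (\<lambda>x. (cmod (u x - trig_proj N u x))\<^sup>2)"
    by (rule integrable_truncation_error[OF u u_le])
  have iE: "integrable Lpi (\<lambda>x. (cmod (?E x))\<^sup>2)"
    by (rule integrable_norm_square_trig_poly)
  have "2 * pi * cmod (\<Sum>k\<in>K. (fourier_coeff (cubic u) k - fourier_coeff (cubic ?v) k) * cnj (e k))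
      = cmod (2 * of_real pi * (\<Sum>k\<in>K. fourier_coeff (cubic u) k * cnj (e k))
           - 2 * of_real pi * (\<Sum>k\<in>K. fourier_coeff (cubic ?v) k * cnj (e k)))"
    by (simp add: left_diff_distrib sum_subtractf norm_mult flip: right_diff_distrib)
  also have "\<dots> = cmod (LINT x|Lpi. cubic u x * cnj (?E x) - cubic ?v x * cnj (?E x))"
  proof -
    have "integrable Lpi (\<lambda>x. f x * cnj (?E x))" if "integrable Lpi f" for f
      by (rule integrable_mult_bounded[OF that, of _ "\<Sum>k\<in>K. cmod (e k)"])
         (auto intro: norm_trig_poly_le borel_measurable_continuous_on[where f=cnj] continuous_intros)
    with iu iv show ?thesis
      by (simp add: integral_mult_cnj_trig_poly)
  qed
  also have "\<dots> \<le> (LINT x|Lpi. cmod (cubic u x * cnj (?E x) - cubic ?v x * cnj (?E x)))"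
    by (rule integral_norm_bound)
  also have "\<dots> \<le> (LINT x|Lpi. 3 * R\<^sup>2 * (3 / 2 * (cmod (?E x))\<^sup>2 + 1 / 2 * (cmod (u x - trig_proj N u x))\<^sup>2))"
  proof (rule integral_mono_AE')
    show "integrable Lpi (\<lambda>x. 3 * R\<^sup>2 * (3 / 2 * (cmod (?E x))\<^sup>2 + 1 / 2 * (cmod (u x - trig_proj N u x))\<^sup>2))"
      using iP iE by auto
    show "AE x in Lpi. cmod (cubic u x * cnj (?E x) - cubic ?v x * cnj (?E x))
        \<le> 3 * R\<^sup>2 * (3 / 2 * (cmod (?E x))\<^sup>2 + 1 / 2 * (cmod (u x - trig_proj N u x))\<^sup>2)"
      using u_le
    proof eventually_elim
      case (elim x)
      let ?p = "cmod (u x - trig_proj N u x)" and ?q = "cmod (?E x)"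
      have "cmod (cubic u x * cnj (?E x) - cubic ?v x * cnj (?E x)) = cmod (cubic u x - cubic ?v x) * ?q"
        by (simp add: norm_mult flip: left_diff_distrib)
      also have "\<dots> \<le> 3 * R\<^sup>2 * cmod (u x - ?v x) * ?q"
        unfolding cubic_def by (intro mult_right_mono cubic_lipschitz elim v_le norm_ge_zero)
      also have "\<dots> \<le> 3 * R\<^sup>2 * (?p + ?q) * ?q"
      proof -
        have "u x - ?v x = (u x - trig_proj N u x) + ?E x" by (simp add: E)
        then have "cmod (u x - ?v x) \<le> ?p + ?q" by (metis norm_triangle_ineq)
        then show ?thesis by (intro mult_right_mono mult_left_mono) auto
      qed
      also have "\<dots> = 3 * R\<^sup>2 * (?p * ?q + ?q\<^sup>2)"
        by (simp add: power2_eq_square algebra_simps)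
      also have "\<dots> \<le> 3 * R\<^sup>2 * (3 / 2 * ?q\<^sup>2 + 1 / 2 * ?p\<^sup>2)"
        using sum_squares_bound[of ?p ?q] by (intro mult_left_mono) auto
      finally show ?case .
    qed
  qed simp
  also have "\<dots> = 3 * R\<^sup>2 * (3 / 2 * (2 * pi * (\<Sum>k\<in>K. (cmod (e k))\<^sup>2))
       + 1 / 2 * (LINT x|Lpi. (cmod (u x - trig_proj N u x))\<^sup>2))"
    using iE iP by (simp add: parseval_trig_poly[OF K] del: times_divide_eq_left)
  also have "\<dots> \<le> 3 * R\<^sup>2 * (3 / 2 * (2 * pi * (\<Sum>k\<in>K. (cmod (e k))\<^sup>2)) + 1 / 2 * (2 * pi * \<delta>\<^sup>2))"
    by (intro mult_left_mono add_left_mono trunc) auto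
  also have "\<dots> = 2 * pi * (R\<^sup>2 / 2 * (9 * (\<Sum>k\<in>K. (cmod (e k))\<^sup>2) + 3 * \<delta>\<^sup>2))"
    by (simp add: algebra_simps)
  finally show ?thesis by (simp only: mult_le_cancel_left_pos[of "2 * pi"] pi_gt_zero zero_less_mult_iff zero_less_numeral simp_thms)
qed

section \<open>Gronwall's inequality and the continuity argument\<close>

text \<open>With the integrating factor, (y + b) e^(-At) has nonpositive derivative, so by the mean
  value theorem it stays below its initial value b.\<close>

lemma gronwall_linear:
  fixes y :: "real \<Rightarrow> real"
  assumes der: "\<And>t. t \<in> {0..T} \<Longrightarrow> (y has_real_derivative y' t) (at t within {0..T})"
    and y': "\<And>t. t \<in> {0..T} \<Longrightarrow> y' t \<le> A * (y t + b)"
    and "y 0 = 0" "0 \<le> b" "t \<in> {0..T}"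
  shows "y t \<le> b * exp (A * t)"
proof -
  define z where "z t = (y t + b) * exp (- A * t)" for t
  have "z t \<le> z 0"
  proof (cases "t = 0")
    case False
    then have t: "0 < t" "t \<le> T" using assms by auto
    have "(z has_derivative (\<lambda>h. h * ((y' r - A * (y r + b)) * exp (- A * r)))) (at r within {0..t})"
      if "0 \<le> r" "r \<le> t" for r
    proof -
      have "(y has_real_derivative y' r) (at r within {0..t})"
        using der[of r] t that by (auto intro: DERIV_subset)
      then have "(z has_real_derivative (y' r - A * (y r + b)) * exp (- A * r)) (at r within {0..t})"
        unfolding z_def[abs_def] by (auto intro!: derivative_eq_intros simp: algebra_simps)
      then show ?thesis by (simp add: has_field_derivative_def mult_commute_abs)
    qed
    from mvt_simple[OF t(1) this] obtain r where r: "r \<in> {0<..<t}"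
      "z t - z 0 = (t - 0) * ((y' r - A * (y r + b)) * exp (- A * r))" by blast
    have "(t - 0) * ((y' r - A * (y r + b)) * exp (- A * r)) \<le> 0"
      using r t y'[of r] by (intro mult_nonneg_nonpos mult_nonpos_nonneg) auto
    with r show ?thesis by linarith
  qed simp
  then have "(y t + b) * exp (- A * t) \<le> b" using assms by (simp add: z_def)
  then have "y t + b \<le> b * exp (A * t)"
    by (simp add: exp_minus field_simps)
  with assms show ?thesis by linarith
qed

text \<open>If g exceeded 1, it would reach 1 at a first time, before which g < 1. The step
  hypothesis at that time gives g < 1 there, a contradiction.\<close>

lemma continuity_bootstrap:
  fixes g :: "real \<Rightarrow> real"
  assumes cont: "continuous_on {0..T} g" and "g 0 < 1"
    and step: "\<And>r. r \<in> {0..T} \<Longrightarrow> (\<And>t. t \<in> {0..r} \<Longrightarrow> g t \<le> 1) \<Longrightarrow> g r < 1"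
    and t: "t \<in> {0..T}"
  shows "g t \<le> 1"
proof (rule ccontr)
  assume "\<not> g t \<le> 1"
  define S where "S = {r \<in> {0..t}. 1 \<le> g r}"
  have "closed S" unfolding S_def
    using continuous_on_subset[OF cont, of "{0..t}"] t by (intro continuous_on_closed_Collect_le) auto
  moreover have "t \<in> S" using \<open>\<not> g t \<le> 1\<close> t by (simp add: S_def)
  moreover have bdd: "bdd_below S" by (auto simp: S_def intro!: bdd_belowI[of _ 0])
  ultimately have r: "Inf S \<in> S" by (intro closed_contains_Inf) auto
  have "g q \<le> 1" if "q \<in> {0..Inf S}" for q
  proof (cases "q = Inf S")
    case True
    \<comment> \<open>At the first time itself g cannot exceed 1: by the intermediate value theorem
      it would have taken the value 1 earlier.\<close>
    show ?thesis
    proof (rule ccontr)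
      assume "\<not> g q \<le> 1"
      then obtain q' where "0 \<le> q'" "q' \<le> q" "g q' = 1"
        using IVT'[of g 0 1 q, OF _ _ _ continuous_on_subset[OF cont]] assms(2) that t r True
        by (force simp: S_def)
      then have "q' \<in> S" using r True by (auto simp: S_def)
      then have "Inf S \<le> q'" using bdd by (rule cInf_lower)
      with \<open>q' \<le> q\<close> True \<open>g q' = 1\<close> \<open>\<not> g q \<le> 1\<close> show False by simp
    qed
  next
    case False
    then have "q < Inf S" using that by simp
    then have "q \<notin> S" using cInf_lower[OF _ bdd, of q] by force
    then show ?thesis using that r by (auto simp: S_def)
  qed
  then have "g (Inf S) < 1" using r t by (intro step) (auto simp: S_def)
  then show False using r by (simp add: S_def)
qed

section \<open>Error estimate\<close>

text \<open>The bounds are required only on [0,r], so that the bootstrap can apply the estimate up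
  to the time reached so far. The parameter \<delta> stays free: it is used once with the H^s and
  once with the H^\<mu> truncation error.\<close>

lemma error_estimate:
  assumes ut: "\<And>t. t \<in> {0..r} \<Longrightarrow> u t \<in> borel_measurable Lpi"
    and uR: "\<And>t. t \<in> {0..r} \<Longrightarrow> AE x in Lpi. cmod (u t x) \<le> R"
    and u_der: "\<And>t k. t \<in> {0..T} \<Longrightarrow> ((\<lambda>\<tau>. fourier_coeff (u \<tau>) k) has_vector_derivative
           (- \<i> * of_real (frac_symbol s k) * fourier_coeff (u t) k
              + \<i> * fourier_coeff (cubic (u t)) k)) (at t within {0..T})"
    and sol: "semidiscrete_solution s T N u0 v"
    and init: "\<And>k. fourier_coeff (u 0) k = fourier_coeff u0 k"
    and r: "r \<in> {0..T}"
    and vR: "\<And>t x. t \<in> {0..r} \<Longrightarrow> cmod (v t x) \<le> R"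
    and trunc: "\<And>t. t \<in> {0..r} \<Longrightarrow> (LINT x|Lpi. (cmod (u t x - trig_proj N (u t) x))\<^sup>2) \<le> 2 * pi * \<delta>\<^sup>2"
    and t: "t \<in> {0..r}"
  shows "(\<Sum>k\<in>{-int N..int N}. (cmod (fourier_coeff (u t) k - fourier_coeff (v t) k))\<^sup>2)
      \<le> \<delta>\<^sup>2 * exp (9 * R\<^sup>2 * T)"
proof -
  let ?K = "{-int N..int N}"
  define e where "e k \<tau> = fourier_coeff (u \<tau>) k - fourier_coeff (v \<tau>) k" for k \<tau>
  define d where "d t k = fourier_coeff (cubic (u t)) k - fourier_coeff (cubic (v t)) k" for t k
  define y where "y \<tau> = (\<Sum>k\<in>?K. (cmod (e k \<tau>))\<^sup>2)" for \<tau>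
  have v: "v \<tau> = trig_poly ?K (fourier_coeff (v \<tau>))" if "\<tau> \<in> {0..T}" for \<tau>
    using sol that by (intro trig_space_eq) (simp add: semidiscrete_solution_def)
  have "(e k has_vector_derivative (- \<i> * of_real (frac_symbol s k) * e k \<tau> + \<i> * d \<tau> k)) (at \<tau> within {0..r})"
    if \<tau>: "\<tau> \<in> {0..r}" and k: "k \<in> ?K" for k \<tau>
  proof -
    have \<tau>T: "\<tau> \<in> {0..T}" using \<tau> r by auto
    have "(e k has_vector_derivative (- \<i> * of_real (frac_symbol s k) * e k \<tau> + \<i> * d \<tau> k)) (at \<tau> within {0..T})"
      unfolding e_def[abs_def]
      by (rule has_vector_derivative_eq_rhs,
          rule has_vector_derivative_diff[OF u_der[OF \<tau>T] semidiscrete_coeff_derivative[OF sol \<tau>T k]])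
         (simp add: d_def algebra_simps)
    then show ?thesis
      by (rule has_vector_derivative_within_subset) (use r in auto)
  qed
  then have der: "(y has_real_derivative - 2 * Im (\<Sum>k\<in>?K. d \<tau> k * cnj (e k \<tau>))) (at \<tau> within {0..r})"
    if "\<tau> \<in> {0..r}" for \<tau>
    unfolding y_def[abs_def] using that by (intro has_real_derivative_sum_cmod_power2) auto
  have "- 2 * Im (\<Sum>k\<in>?K. d \<tau> k * cnj (e k \<tau>)) \<le> (9 * R\<^sup>2) * (y \<tau> + \<delta>\<^sup>2 / 3)" if \<tau>: "\<tau> \<in> {0..r}" for \<tau>
  proof -
    have vt: "trig_poly ?K (fourier_coeff (v \<tau>)) = v \<tau>" using v[of \<tau>] \<tau> r by auto
    have "cmod (\<Sum>k\<in>?K. d \<tau> k * cnj (e k \<tau>)) \<le> R\<^sup>2 / 2 * (9 * y \<tau> + 3 * \<delta>\<^sup>2)"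
      using nonlinear_term_bound[OF ut[OF \<tau>] uR[OF \<tau>], of N "fourier_coeff (v \<tau>)" \<delta>]
        vR[OF \<tau>] trunc[OF \<tau>] unfolding y_def d_def e_def vt by blast
    moreover have "- Im (\<Sum>k\<in>?K. d \<tau> k * cnj (e k \<tau>)) \<le> cmod (\<Sum>k\<in>?K. d \<tau> k * cnj (e k \<tau>))"
      using abs_Im_le_cmod[of "\<Sum>k\<in>?K. d \<tau> k * cnj (e k \<tau>)"] by linarith
    moreover have "(9 * R\<^sup>2) * (y \<tau> + \<delta>\<^sup>2 / 3) = 2 * (R\<^sup>2 / 2 * (9 * y \<tau> + 3 * \<delta>\<^sup>2))"
      by (simp add: algebra_simps)
    ultimately show ?thesis by linarith
  qed
  moreover have "y 0 = 0"
  proof -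
    have "v 0 = trig_poly ?K (fourier_coeff u0)" using sol by (simp add: semidiscrete_solution_def trig_proj_eq)
    then have "fourier_coeff (v 0) k = fourier_coeff u0 k" if "k \<in> ?K" for k
      using that by (simp add: fourier_coeff_trig_poly)
    then show ?thesis by (simp add: y_def e_def init)
  qed
  ultimately have "y t \<le> \<delta>\<^sup>2 / 3 * exp (9 * R\<^sup>2 * t)"
    using der t by (intro gronwall_linear) auto
  \<comment> \<open>The factor 1/3 is given up and t is replaced by T, which makes the bound
    independent of r and t.\<close>
  also have "\<dots> \<le> \<delta>\<^sup>2 * exp (9 * R\<^sup>2 * T)"
    using t r by (intro mult_mono) (auto intro!: mult_left_mono)
  finally show ?thesis by (simp add: y_def e_def)
qed

text \<open>Cauchy-Schwarz over the 2N + 1 modes makes the sum of the moduli of the coefficient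
  errors at most 1; the coefficients of f add at most \<open>M0\<close>.\<close>

lemma sup_norm_error_bound:
  fixes c :: "int \<Rightarrow> complex"
  assumes "\<And>K. finite K \<Longrightarrow> (\<Sum>k\<in>K. cmod (fourier_coeff f k)) \<le> M0"
    and "real (2 * N + 1) * (\<Sum>k\<in>{-int N..int N}. (cmod (fourier_coeff f k - c k))\<^sup>2) \<le> 1"
  shows "cmod (trig_poly {-int N..int N} c x) \<le> M0 + 1"
proof -
  let ?K = "{-int N..int N}"
  have "(\<Sum>k\<in>?K. cmod (fourier_coeff f k - c k))\<^sup>2
      \<le> (\<Sum>k\<in>?K. (cmod (fourier_coeff f k - c k))\<^sup>2) * real (card ?K)"
    by (rule sum_squared_le_sum_of_squares)
  also have "\<dots> \<le> 1\<^sup>2" using assms(2) by (simp add: algebra_simps)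
  finally have "(\<Sum>k\<in>?K. cmod (fourier_coeff f k - c k)) \<le> 1"
    by (rule power2_le_imp_le) simp
  moreover have "cmod (trig_poly ?K c x) \<le> (\<Sum>k\<in>?K. cmod (fourier_coeff f k) + cmod (fourier_coeff f k - c k))"
    by (intro order_trans[OF norm_trig_poly_le] sum_mono) (metis norm_minus_commute norm_triangle_sub)
  ultimately show ?thesis using assms(1)[of ?K] by (simp add: sum.distrib)
qed

text \<open>Triangle inequality through P_N f. The factor 4 pi is 2 from (p + q)^2 \<le> 2p^2 + 2q^2
  times 2 pi from Parseval.\<close>

lemma L2_norm_per_le:
  assumes f: "f \<in> borel_measurable Lpi" and fR: "AE x in Lpi. cmod (f x) \<le> R"
    and trunc: "(LINT x|Lpi. (cmod (f x - trig_proj N f x))\<^sup>2) \<le> 2 * pi * \<delta>\<^sup>2"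
    and y: "(\<Sum>k\<in>{-int N..int N}. (cmod (fourier_coeff f k - c k))\<^sup>2) \<le> y"
  shows "L2_norm_per (\<lambda>x. trig_poly {-int N..int N} c x - f x) \<le> sqrt (4 * pi * (y + \<delta>\<^sup>2))"
proof -
  let ?K = "{-int N..int N}"
  let ?E = "trig_poly ?K (\<lambda>k. fourier_coeff f k - c k)"
  have E: "?E x = trig_proj N f x - trig_poly ?K c x" for x
    by (simp add: trig_proj_def trig_poly_def left_diff_distrib sum_subtractf)
  have iP: "integrable Lpi (\<lambda>x. (cmod (f x - trig_proj N f x))\<^sup>2)"
    by (rule integrable_truncation_error[OF f fR])
  have iE: "integrable Lpi (\<lambda>x. (cmod (?E x))\<^sup>2)"
    by (rule integrable_norm_square_trig_poly)
  have "L2_inner (\<lambda>x. trig_poly ?K c x - f x) (\<lambda>x. trig_poly ?K c x - f x)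
      = of_real (LINT x|Lpi. (cmod (trig_poly ?K c x - f x))\<^sup>2)"
    unfolding L2_inner_def by (simp only: integral_complex_of_real[symmetric] complex_norm_square)
  then have "L2_norm_per (\<lambda>x. trig_poly ?K c x - f x) = sqrt (LINT x|Lpi. (cmod (trig_poly ?K c x - f x))\<^sup>2)"
    by (simp only: L2_norm_per_def Re_complex_of_real)
  also have "\<dots> \<le> sqrt (LINT x|Lpi. 2 * (cmod (?E x))\<^sup>2 + 2 * (cmod (f x - trig_proj N f x))\<^sup>2)"
  proof (intro real_sqrt_le_mono integral_mono_AE' AE_I2)
    show "integrable Lpi (\<lambda>x. 2 * (cmod (?E x))\<^sup>2 + 2 * (cmod (f x - trig_proj N f x))\<^sup>2)"
      using iE iP by auto
    fix x
    let ?p = "cmod (?E x)" and ?q = "cmod (f x - trig_proj N f x)"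
    have "cmod (trig_poly ?K c x - f x) = cmod (?E x + (f x - trig_proj N f x))"
      by (simp add: E norm_minus_commute)
    also have "\<dots> \<le> ?p + ?q" by (rule norm_triangle_ineq)
    finally have "(cmod (trig_poly ?K c x - f x))\<^sup>2 \<le> (?p + ?q)\<^sup>2" by (rule power_mono) simp
    also have "\<dots> \<le> 2 * ?p\<^sup>2 + 2 * ?q\<^sup>2"
      using sum_squares_bound[of ?p ?q] by (simp add: power2_sum)
    finally show "(cmod (trig_poly ?K c x - f x))\<^sup>2 \<le> 2 * ?p\<^sup>2 + 2 * ?q\<^sup>2" .
  qed simp
  also have "(LINT x|Lpi. 2 * (cmod (?E x))\<^sup>2 + 2 * (cmod (f x - trig_proj N f x))\<^sup>2)
      = 2 * (2 * pi * (\<Sum>k\<in>?K. (cmod (fourier_coeff f k - c k))\<^sup>2))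
        + 2 * (LINT x|Lpi. (cmod (f x - trig_proj N f x))\<^sup>2)"
    using iE iP by (simp add: parseval_trig_poly)
  also have "sqrt \<dots> \<le> sqrt (2 * (2 * pi * y) + 2 * (2 * pi * \<delta>\<^sup>2))"
    by (intro real_sqrt_le_mono add_mono mult_left_mono y trunc) auto
  finally show ?thesis by (simp add: algebra_simps)
qed

text \<open>Each term is at most the whole sum, hence at most M. It converts the absolute
  summability bound into a mass bound.\<close>

lemma sum_squares_le_square_of_sum:
  fixes f :: "'k \<Rightarrow> real"
  assumes "finite K" "\<And>k. k \<in> K \<Longrightarrow> 0 \<le> f k" "sum f K \<le> M"
  shows "(\<Sum>k\<in>K. (f k)\<^sup>2) \<le> M\<^sup>2"
proof -
  have "(\<Sum>k\<in>K. (f k)\<^sup>2) \<le> (\<Sum>k\<in>K. f k * M)"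
    unfolding power2_eq_square
    by (intro sum_mono mult_left_mono assms(2) order_trans[OF member_le_sum assms(3)]) (auto simp: assms)
  also have "\<dots> = sum f K * M" by (simp add: sum_distrib_right)
  also have "\<dots> \<le> M * M"
    using assms(3) sum_nonneg[of K f] assms(2) by (intro mult_right_mono) auto
  finally show ?thesis by (simp add: power2_eq_square)
qed

theorem theorem2p2:
  fixes s T \<mu> :: real
    and u0 :: "real \<Rightarrow> complex"
    and u :: "real \<Rightarrow> real \<Rightarrow> complex"
  assumes "0 < T"
    and "1 / 2 < s" and "s \<le> 1"
    and "smooth u0" and "periodic2pi u0"
    and "0 < \<mu>"
    and "fnls_solution s T u0 u"
    and "\<forall>t\<in>{0..T}. u t \<in> sobolev_space \<mu>"
    and "bdd_above ((\<lambda>t. sobolev_norm \<mu> (u t)) ` {0..T})"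
  shows "\<exists>C::real. \<forall>N\<ge>1. \<forall>uN :: real \<Rightarrow> real \<Rightarrow> complex.
           semidiscrete_solution s T N u0 uN \<longrightarrow>
           1 - (C_infty s)\<^sup>2 * mass_I1 (uN 0) > 0 \<longrightarrow>
           mass_I1 (uN 0) / 2 + energy_H s (uN 0) \<ge> 0 \<longrightarrow>
           (\<forall>t\<in>{0..T}. L2_norm_per (\<lambda>x. uN t x - u t x) \<le> C * real N powr (- \<mu>))"
proof -
  have us: "u t \<in> sobolev_space s" if "t \<in> {0..T}" for t
    using assms(7) that by (simp add: fnls_solution_def)
  have u\<mu>: "u t \<in> sobolev_space \<mu>" if "t \<in> {0..T}" for t
    using assms(8) that by blast
  obtain Bs where Bs: "\<And>t. t \<in> {0..T} \<Longrightarrow> sobolev_norm s (u t) \<le> Bs"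
    using assms(7) unfolding fnls_solution_def bdd_above_def by blast
  obtain B\<mu> where B\<mu>: "\<And>t. t \<in> {0..T} \<Longrightarrow> sobolev_norm \<mu> (u t) \<le> B\<mu>"
    using assms(9) unfolding bdd_above_def by blast
  have B\<mu>_nonneg: "0 \<le> B\<mu>"
  proof -
    have "0 \<le> sobolev_norm \<mu> (u 0)" by (simp add: sobolev_norm_def infsum_nonneg)
    then show ?thesis using B\<mu>[of 0] \<open>0 < T\<close> by simp
  qed
  define M0 where "M0 = ((\<Sum>\<^sub>\<infinity>k::int. (1 + (real_of_int k)\<^sup>2) powr (- s)) + Bs\<^sup>2) / 2"
  have M0: "(\<Sum>k\<in>K. cmod (fourier_coeff (u t) k)) \<le> M0" if "t \<in> {0..T}" "finite K" for t K
    unfolding M0_def by (rule sobolev_sum_coeffs_le[OF \<open>1/2 < s\<close> us Bs]) (use that in auto)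
  have u_int: "integrable Lpi (u t)" if "t \<in> {0..T}" for t
    using us[OF that] L2_per_integrable by (simp add: sobolev_space_def)
  have u_meas: "u t \<in> borel_measurable Lpi" if "t \<in> {0..T}" for t
    using u_int[OF that] by auto
  \<comment> \<open>The truncations are bounded by \<open>M0\<close> and converge almost everywhere.
    The extra 1 matches the radius \<open>R\<close> shared with the semidiscrete solution.\<close>
  have u_le: "AE x in Lpi. cmod (u t x) \<le> M0 + 1" if t: "t \<in> {0..T}" for t
  proof -
    have "AE x in Lpi. (\<lambda>M. trig_proj M (u t) x) \<longlonglongrightarrow> u t x"
      by (rule absolutely_summable_coeffs_imp_series_converges[OF u_int M0]) (use t in auto)
    then show ?thesis
    proof eventually_elim
      case (elim x)
      have "cmod (trig_proj M (u t) x) \<le> M0" for M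
        unfolding trig_proj_eq by (rule order_trans[OF norm_trig_poly_le M0[OF t]]) simp
      then have "cmod (u t x) \<le> M0"
        by (intro tendsto_upperbound[OF tendsto_norm[OF elim]]) simp_all
      then show ?case by simp
    qed
  qed
  have u_der: "((\<lambda>\<tau>. fourier_coeff (u \<tau>) k) has_vector_derivative
           (- \<i> * of_real (frac_symbol s k) * fourier_coeff (u t) k
              + \<i> * fourier_coeff (cubic (u t)) k)) (at t within {0..T})" if "t \<in> {0..T}" for t k
    using assms(7) that unfolding fnls_solution_def by blast
  have init: "fourier_coeff (u 0) k = fourier_coeff u0 k" for k
  proof (rule fourier_coeff_AE_cong)
    show "AE x in Lpi. u 0 x = u0 x"
      using assms(7) by (auto simp: fnls_solution_def AE_restrict_space_iff)
    show "u 0 \<in> borel_measurable Lpi" using u_meas \<open>0 < T\<close> by auto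
    obtain D where "D 0 = u0" "\<And>x. (D 0 has_vector_derivative D (Suc 0) x) (at x)"
      using \<open>smooth u0\<close> unfolding smooth_def by metis
    then have "continuous_on UNIV u0"
      by (metis has_vector_derivative_continuous continuous_at_imp_continuous_on)
    then show "u0 \<in> borel_measurable Lpi" by (rule measurable_lebesgue_on_pi)
  qed
  \<comment> \<open>The margin 1 above \<open>M0\<close> leaves room for the deviation of the
    semidiscrete solution from the exact one.\<close>
  define R where "R = M0 + 1"
  define Q where "Q = exp (9 * R\<^sup>2 * T)"
  \<comment> \<open>The exponent 1 - 2s is negative. The 3 comes from 2N + 1 \<le> 3N, and the
    expression is the bound on (2N + 1) y in the bootstrap; from \<open>N0\<close> on it is below
    1.\<close>
  have "((\<lambda>n. Bs\<^sup>2 * Q * 3 * real n powr (1 - 2 * s)) \<longlongrightarrow> Bs\<^sup>2 * Q * 3 * 0) sequentially"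
    by (intro tendsto_mult tendsto_const tendsto_neg_powr filterlim_real_sequentially) (use assms in auto)
  then have "\<forall>\<^sub>F n in sequentially. Bs\<^sup>2 * Q * 3 * real n powr (1 - 2 * s) < 1"
    by (intro order_tendstoD(2)[where y="Bs\<^sup>2 * Q * 3 * 0"]) auto
  then obtain N0 where N0: "\<And>n. n \<ge> N0 \<Longrightarrow> Bs\<^sup>2 * Q * 3 * real n powr (1 - 2 * s) < 1"
    by (auto simp: eventually_sequentially)
  \<comment> \<open>\<open>C1\<close> serves N \<ge> \<open>N0\<close>. For smaller N the error is
    merely bounded, and the power of \<open>Suc N0\<close> in \<open>C2\<close> makes up for
    N^(-\<mu>).\<close>
  define C1 where "C1 = sqrt (4 * pi * (Q + 1)) * B\<mu>"
  define C2 where "C2 = sqrt (4 * pi * (4 * M0\<^sup>2 + B\<mu>\<^sup>2)) * real (Suc N0) powr \<mu>"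
  show ?thesis
  proof (intro exI[of _ "max C1 C2"] allI impI ballI)
    fix N :: nat and v :: "real \<Rightarrow> real \<Rightarrow> complex" and t
    assume N: "1 \<le> N" and sol: "semidiscrete_solution s T N u0 v" and t: "t \<in> {0..T}"
    let ?K = "{-int N..int N}"
    define y where "y t = (\<Sum>k\<in>?K. (cmod (fourier_coeff (u t) k - fourier_coeff (v t) k))\<^sup>2)" for t
    have v: "v \<tau> = trig_poly ?K (fourier_coeff (v \<tau>))" if "\<tau> \<in> {0..T}" for \<tau>
      using sol that by (intro trig_space_eq) (simp add: semidiscrete_solution_def)
    have trunc: "(LINT x|Lpi. (cmod (u \<tau> x - trig_proj N (u \<tau>) x))\<^sup>2) \<le> 2 * pi * (B\<mu> * real N powr (- \<mu>))\<^sup>2"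
      if "\<tau> \<in> {0..T}" for \<tau>
      by (rule L2_truncation_error[OF u\<mu> B\<mu> \<open>0 < \<mu>\<close> N M0]) (use that in auto)
    have L2: "L2_norm_per (\<lambda>x. v t x - u t x) \<le> sqrt (4 * pi * (Y + (B\<mu> * real N powr (- \<mu>))\<^sup>2))"
      if "y t \<le> Y" for Y
      using L2_norm_per_le[OF u_meas[OF t] u_le[OF t] trunc[OF t] that[unfolded y_def]] v[OF t] by simp
    show "L2_norm_per (\<lambda>x. v t x - u t x) \<le> max C1 C2 * real N powr (- \<mu>)"
    proof (cases "N0 \<le> N")
      case True
      have vR: "cmod (v \<tau> x) \<le> R" if "real (2 * N + 1) * y \<tau> \<le> 1" "\<tau> \<in> {0..T}" for \<tau> x
        unfolding R_def using that
        by (subst v) (auto intro!: sup_norm_error_bound M0 simp: y_def)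
      have y_le: "y \<tau> \<le> \<delta>\<^sup>2 * Q"
        if "r \<in> {0..T}" "\<And>q. q \<in> {0..r} \<Longrightarrow> real (2 * N + 1) * y q \<le> 1" "\<tau> \<in> {0..r}"
          "\<And>q. q \<in> {0..T} \<Longrightarrow> (LINT x|Lpi. (cmod (u q x - trig_proj N (u q) x))\<^sup>2) \<le> 2 * pi * \<delta>\<^sup>2"
        for r \<tau> \<delta>
        unfolding y_def Q_def
        by (rule error_estimate[OF _ _ u_der sol init, of r R])
           (use that u_meas u_le vR in \<open>auto simp: R_def\<close>)
      \<comment> \<open>The bootstrapped quantity dominates the squared sup norm of P_N u - v, and
        its bound 1 is what \<open>vR\<close> asks for.\<close>
      have small: "real (2 * N + 1) * y \<tau> \<le> 1" if "\<tau> \<in> {0..T}" for \<tau>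
      proof (rule continuity_bootstrap[of T "\<lambda>\<tau>. real (2 * N + 1) * y \<tau>"])
        have "continuous_on {0..T} (\<lambda>\<tau>. fourier_coeff (u \<tau>) k)" for k
          unfolding continuous_on_eq_continuous_within
          by (blast intro: has_vector_derivative_continuous u_der)
        moreover have "continuous_on {0..T} (\<lambda>\<tau>. fourier_coeff (v \<tau>) k)" if "k \<in> ?K" for k
          unfolding continuous_on_eq_continuous_within
          by (blast intro: has_vector_derivative_continuous semidiscrete_coeff_derivative[OF sol _ that])
        ultimately show "continuous_on {0..T} (\<lambda>\<tau>. real (2 * N + 1) * y \<tau>)"
          unfolding y_def by (intro continuous_intros) auto
        have step: "real (2 * N + 1) * y r < 1"
          if r: "r \<in> {0..T}" and le: "\<And>q. q \<in> {0..r} \<Longrightarrow> real (2 * N + 1) * y q \<le> 1" for r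
        proof -
          \<comment> \<open>First use of the estimate, with the H^s truncation error: its rate
            suffices to close the bootstrap whatever \<mu> is.\<close>
          have "y r \<le> (Bs * real N powr (- s))\<^sup>2 * Q"
            by (rule y_le[OF r le]) (use r M0 us Bs N assms in \<open>auto intro!: L2_truncation_error\<close>)
          then have "real (2 * N + 1) * y r \<le> 3 * real N * ((Bs * real N powr (- s))\<^sup>2 * Q)"
            using N by (intro mult_mono) (auto simp: y_def sum_nonneg)
          also have "\<dots> = Bs\<^sup>2 * Q * 3 * real N powr (1 - 2 * s)"
          proof -
            have "real N powr (1 - 2 * s) = real N powr 1 * (real N powr (- s) * real N powr (- s))"
              unfolding powr_add[symmetric] by (rule arg_cong[where f="\<lambda>p. real N powr p"]) simp
            then show ?thesis using N by (simp add: power2_eq_square)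
          qed
          also have "\<dots> < 1" using N0[OF True] .
          finally show ?thesis .
        qed
        then show "\<And>r. r \<in> {0..T} \<Longrightarrow> (\<And>t. t \<in> {0..r} \<Longrightarrow> real (2 * N + 1) * y t \<le> 1) \<Longrightarrow> real (2 * N + 1) * y r < 1"
          by blast
        have "v 0 = trig_poly ?K (fourier_coeff u0)" using sol by (simp add: semidiscrete_solution_def trig_proj_eq)
        then have "y 0 = 0" by (simp add: y_def init fourier_coeff_trig_poly)
        then show "real (2 * N + 1) * y 0 < 1" by simp
      qed (rule that)
      \<comment> \<open>Second use: the sup bound now holds on all of [0,T], so the H^\<mu>
        truncation error gives the claimed rate.\<close>
      have "y t \<le> (B\<mu> * real N powr (- \<mu>))\<^sup>2 * Q"
        by (rule y_le[of T]) (use t small trunc \<open>0 < T\<close> in auto)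
      from L2[OF this] have "L2_norm_per (\<lambda>x. v t x - u t x)
          \<le> sqrt (4 * pi * (Q + 1) * (B\<mu> * real N powr (- \<mu>))\<^sup>2)"
        by (simp add: algebra_simps)
      also have "\<dots> = C1 * real N powr (- \<mu>)"
        using B\<mu>_nonneg by (simp add: C1_def real_sqrt_mult)
      finally show ?thesis
        by (rule order_trans) (simp add: mult_right_mono)
    next
      case False
      have zero: "0 \<in> {0..T}" using \<open>0 < T\<close> by simp
      have a_le: "(\<Sum>k\<in>?K. (cmod (fourier_coeff (u \<tau>) k))\<^sup>2) \<le> M0\<^sup>2" if "\<tau> \<in> {0..T}" for \<tau>
        by (rule sum_squares_le_square_of_sum[OF _ _ M0[OF that]]) auto
      \<comment> \<open>The retained coefficients of v(0) are those of u(0), so mass conservation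
        carries the bound \<open>M0\<close> squared to v(t).\<close>
      have "v 0 = trig_poly ?K (fourier_coeff (u 0))"
        using sol by (simp add: semidiscrete_solution_def trig_proj_eq init[abs_def])
      then have c_le: "(\<Sum>k\<in>?K. (cmod (fourier_coeff (v t) k))\<^sup>2) \<le> M0\<^sup>2"
        unfolding semidiscrete_mass_conservation[OF sol t]
        using a_le[OF zero] by (simp add: fourier_coeff_trig_poly)
      have "y t \<le> (\<Sum>k\<in>?K. 2 * (cmod (fourier_coeff (u t) k))\<^sup>2 + 2 * (cmod (fourier_coeff (v t) k))\<^sup>2)"
        unfolding y_def
      proof (rule sum_mono)
        fix k
        let ?p = "cmod (fourier_coeff (u t) k)" and ?q = "cmod (fourier_coeff (v t) k)"
        have "(cmod (fourier_coeff (u t) k - fourier_coeff (v t) k))\<^sup>2 \<le> (?p + ?q)\<^sup>2"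
          by (intro power_mono norm_triangle_ineq4) simp
        then show "(cmod (fourier_coeff (u t) k - fourier_coeff (v t) k))\<^sup>2 \<le> 2 * ?p\<^sup>2 + 2 * ?q\<^sup>2"
          using sum_squares_bound[of ?p ?q] by (simp add: power2_sum)
      qed
      also have "\<dots> \<le> 4 * M0\<^sup>2"
        using a_le[OF t] c_le by (simp add: sum.distrib flip: sum_distrib_left)
      finally have "L2_norm_per (\<lambda>x. v t x - u t x) \<le> sqrt (4 * pi * (4 * M0\<^sup>2 + (B\<mu> * real N powr (- \<mu>))\<^sup>2))"
        by (rule L2)
      also have "\<dots> \<le> sqrt (4 * pi * (4 * M0\<^sup>2 + (B\<mu> * 1)\<^sup>2)) * 1"
      proof -
        have "real N powr (- \<mu>) \<le> 1" using N assms(6) ge_one_powr_ge_zero[of "real N" \<mu>]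
          by (simp add: powr_minus inverse_le_1_iff)
        then show ?thesis
          unfolding mult_1_right
          by (intro real_sqrt_le_mono mult_left_mono add_left_mono power_mono) (use B\<mu>_nonneg in \<open>auto simp: mult_left_le\<close>)
      qed
      also have "\<dots> \<le> sqrt (4 * pi * (4 * M0\<^sup>2 + (B\<mu> * 1)\<^sup>2)) * (real (Suc N0) powr \<mu> * real N powr (- \<mu>))"
      proof (rule mult_left_mono)
        have "real N powr \<mu> \<le> real (Suc N0) powr \<mu>" using False assms(6) by (intro powr_mono2) auto
        then show "1 \<le> real (Suc N0) powr \<mu> * real N powr (- \<mu>)"
          using N by (simp add: powr_minus field_simps)
      qed simp
      also have "\<dots> = C2 * real N powr (- \<mu>)" by (simp add: C2_def)
      finally show ?thesis
        by (rule order_trans) (simp add: mult_right_mono)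
    qed
  qed
qed

end
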